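(* Let $m\ge n+1\ge3$. Let $F:\mathbb{B}^n\to D^{IV}_m$ be a holomorphic isometry which is a rational map and satisfies $F(0)=0$. Then $\deg(F)\le2$; more precisely, either $F$ is a (homogeneous) linear map or $\deg(F)=2$.
   Context: $\mathbb{B}^n=\{z\in\mathbb{C}^n:|z|^2<1\}$; $D^{IV}_m=\{Z\in\mathbb{C}^m: Z\overline{Z}^t<2,\ 1-Z\overline{Z}^t+\tfrac14|ZZ^t|^2>0\}$. Bergman metric $\omega_\Omega=\sqrt{-1}\partial\bar\partial\log K_\Omega$ with $K_{\mathbb{B}^n}=c(1-|z|^2)^{-(n+1)}$, $K_{D^{IV}_m}=c'(1-Z\overline{Z}^t+\tfrac14|ZZ^t|^2)^{-m}$; a holomorphic $F$ is a holomorphic isometry if $F^*\omega_{D^{IV}_m}=\lambda\omega_{\mathbb{B}^n}$ for a constant $\lambda>0$. For a rational map $F=(P_1,\dots,P_m)/R$ written in lowest terms with $P_j,R$ polynomials, $\deg(F)=\max\{\deg P_1,\dots,\deg P_m,\deg R\}$. *)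

theory Defs
  imports "HOL-Analysis.Analysis" "HOL-Library.Poly_Mapping"
begin

text \<open>Points of C^n are vectors complex^'n (n = CARD('n)).
 Polynomials in the n complex coordinates: monomials are exponent maps 'n =>0 nat,
 polynomials are finitely supported coefficient maps (a commutative ring under
 the convolution product of Poly_Mapping).\<close>

definition unit_ball :: "(complex^'n::finite) set" where
  "unit_ball = {z. (\<Sum>j\<in>UNIV. (cmod (z $ j))^2) < 1}"

type_synonym 'n mpoly = "('n \<Rightarrow>\<^sub>0 nat) \<Rightarrow>\<^sub>0 complex"

definition mpeval :: "'n::finite mpoly \<Rightarrow> complex^'n \<Rightarrow> complex" where
  "mpeval p z = (\<Sum>a\<in>Poly_Mapping.keys p. Poly_Mapping.lookup p a * (\<Prod>j\<in>(UNIV::'n set). (z $ j) ^ Poly_Mapping.lookup (a::'n \<Rightarrow>\<^sub>0 nat) j))"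

definition mdeg :: "'n::finite mpoly \<Rightarrow> nat" where
  "mdeg p = Max (insert 0 ((\<lambda>a::'n \<Rightarrow>\<^sub>0 nat. \<Sum>j\<in>(UNIV::'n set). Poly_Mapping.lookup a j) ` Poly_Mapping.keys p))"

definition lowest_terms_rep ::
  "('n::finite mpoly) ^'m \<Rightarrow> 'n mpoly \<Rightarrow> bool" where
  "lowest_terms_rep P R \<longleftrightarrow> R \<noteq> 0 \<and>
     (\<forall>D. (\<forall>k. D dvd P $ k) \<and> D dvd R \<longrightarrow> D dvd 1)"

definition rational_rep ::
  "(complex^'n::finite \<Rightarrow> complex^'m::finite) \<Rightarrow> ('n mpoly)^'m \<Rightarrow> 'n mpoly \<Rightarrow> bool" where
  "rational_rep F P R \<longleftrightarrow> lowest_terms_rep P R \<and>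
     (\<forall>z\<in>unit_ball. mpeval R z \<noteq> 0 \<longrightarrow>
          F z = (\<chi> k. mpeval (P $ k) z / mpeval R z))"

definition rdeg :: "('n::finite mpoly)^'m::finite \<Rightarrow> 'n mpoly \<Rightarrow> nat" where
  "rdeg P R = max (Max (range (\<lambda>k. mdeg (P $ k)))) (mdeg R)"

definition typeIV_domain :: "(complex^'m::finite) set" where
  "typeIV_domain = {Z. (\<Sum>j\<in>UNIV. (cmod (Z $ j))^2) < 2 \<and>
     1 - (\<Sum>j\<in>UNIV. (cmod (Z $ j))^2) + (cmod (\<Sum>j\<in>UNIV. (Z $ j)^2))^2 / 4 > 0}"

text \<open>Bergman kernels on the diagonal (normalising constants c, c' > 0 as parameters)\<close>
definition K_ball :: "real \<Rightarrow> complex^'n::finite \<Rightarrow> real" where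
  "K_ball c z = c * (1 - (\<Sum>j\<in>UNIV. (cmod (z $ j))^2)) powr (- real (CARD('n) + 1))"

definition K_IV :: "real \<Rightarrow> complex^'m::finite \<Rightarrow> real" where
  "K_IV c Z = c * (1 - (\<Sum>j\<in>UNIV. (cmod (Z $ j))^2) + (cmod (\<Sum>j\<in>UNIV. (Z $ j)^2))^2 / 4)
                 powr (- real CARD('m))"

definition holo_on :: "(complex^'n::finite \<Rightarrow> complex^'m::finite) \<Rightarrow> (complex^'n) set \<Rightarrow> bool" where
  "holo_on F S \<longleftrightarrow> (\<forall>z\<in>S. \<exists>L. (F has_derivative L) (at z) \<and>
        (\<forall>c v. L (c *s v) = c *s L v))"

text \<open>Wirtinger derivatives and the coefficient matrix of i ddbar phi
  (i ddbar phi = i sum_{j,k} levi phi z j k dz_j wedge dzbar_k).\<close>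
definition pdir :: "(complex^'n::finite \<Rightarrow> complex) \<Rightarrow> complex^'n \<Rightarrow> complex^'n \<Rightarrow> complex" where
  "pdir g v z = vector_derivative (\<lambda>t::real. g (z + t *\<^sub>R v)) (at 0)"

definition wd :: "'n::finite \<Rightarrow> (complex^'n \<Rightarrow> complex) \<Rightarrow> complex^'n \<Rightarrow> complex" where
  "wd j g z = (pdir g (axis j 1) z - \<i> * pdir g (axis j \<i>) z) / 2"

definition wdbar :: "'n::finite \<Rightarrow> (complex^'n \<Rightarrow> complex) \<Rightarrow> complex^'n \<Rightarrow> complex" where
  "wdbar j g z = (pdir g (axis j 1) z + \<i> * pdir g (axis j \<i>) z) / 2"

definition levi :: "(complex^'n::finite \<Rightarrow> real) \<Rightarrow> complex^'n \<Rightarrow> 'n \<Rightarrow> 'n \<Rightarrow> complex" where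
  "levi \<phi> z j k = wd j (\<lambda>w. wdbar k (\<lambda>u. complex_of_real (\<phi> u)) w) z"

text \<open>Holomorphic isometry F^* omega_D = lambda omega_B. For holomorphic F,
  F^*(i ddbar log K_D) = i ddbar (log K_D o F).\<close>
definition holo_isometry ::
  "real \<Rightarrow> real \<Rightarrow> (complex^'n::finite \<Rightarrow> complex^'m::finite) \<Rightarrow> real \<Rightarrow> bool" where
  "holo_isometry c c' F lam \<longleftrightarrow> holo_on F unit_ball \<and> F ` unit_ball \<subseteq> typeIV_domain \<and>
     (\<forall>z\<in>unit_ball. \<forall>j k. levi (\<lambda>w. ln (K_IV c' (F w))) z j k
                         = lam * levi (\<lambda>w. ln (K_ball c w)) z j k)"

end

theory Submission
  imports Defs "HOL-Complex_Analysis.Complex_Analysis"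
begin

text \<open>
  Write \<open>F \<cdot> F\<close> for the sum of the squares of the components,
  \<open>N(z, w) = 1 - \<langle>F z, F w\<rangle> + (F z \<cdot> F z) cnj (F w \<cdot> F w) / 4\<close> and \<open>\<mu> = \<lambda>(n + 1)/m\<close>. By the isometry
  condition the \<open>(1,0)\<close>-derivative of \<open>log N(z, z) - \<mu> log (1 - |z|\<^sup>2)\<close> is holomorphic; polarizing it
  and setting the conjugate variable to 0 shows that it vanishes, and then the polarized identity
  reads \<open>(1 - \<langle>z, w\<rangle>) \<partial>\<^sub>z N = \<mu> N \<partial>\<^sub>z (1 - \<langle>z, w\<rangle>)\<close>. On a complex line through 0, \<open>N\<close> is a rational
  function of \<open>z\<close> whose logarithmic derivative has residue \<open>\<mu>\<close>, so \<open>\<mu>\<close> is an integer and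
  \<open>N(z, w) = (1 - \<langle>z, w\<rangle>)^\<mu>\<close>. Here \<open>\<mu> \<ge> 2\<close> is impossible: as \<open>n \<ge> 2\<close>, there is \<open>v \<noteq> 0\<close> with \<open>F'(0)v\<close>
  isotropic, and the second Taylor coefficient of \<open>F\<close> along \<open>v\<close> would have a negative squared norm.

  For \<open>\<mu> = 1\<close> we get \<open>\<langle>F z, F w\<rangle> = \<langle>z, w\<rangle> + g(z) cnj (g(w))\<close> with \<open>g = F \<cdot> F / 2\<close>. Hence
  \<open>F = Az\<close>, or \<open>F = Az + g b\<close> with a unit vector \<open>b\<close> orthogonal to the range of \<open>A\<close>. In the latter
  case \<open>(b \<cdot> b) g\<^sup>2 - 2(1 - l) g + q = 0\<close> where \<open>l = Az \<cdot> b\<close> and \<open>q = Az \<cdot> Az\<close>. If \<open>q = 0\<close>, then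
  \<open>g = 0\<close>. Otherwise rationality of \<open>g\<close> makes the discriminant a square on every line through 0,
  which forces \<open>b \<cdot> b = 0\<close>, and \<open>F = Az + q b / (2(1 - l))\<close> has degree 2.
\<close>

unbundle no Formal_Power_Series.fps_syntax

section \<open>Bilinear and Hermitian products\<close>

definition cdot :: "complex^'n::finite \<Rightarrow> complex^'n \<Rightarrow> complex" (infixl "\<cdot>" 70) where
  "u \<cdot> v = (\<Sum>i\<in>UNIV. u $ i * v $ i)"

definition cinner :: "complex^'n::finite \<Rightarrow> complex^'n \<Rightarrow> complex" ("\<langle>_, _\<rangle>") where
  "\<langle>u, v\<rangle> = (\<Sum>i\<in>UNIV. u $ i * cnj (v $ i))"

lemma norm_vector_scalar_mult:
  fixes v :: "'a::real_normed_field^'n::finite"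
  shows "norm (c *s v) = norm c * norm v"
  by (simp add: norm_vec_def L2_set_right_distrib norm_mult)

lemma norm_cdot_le: "cmod (u \<cdot> v) \<le> norm u * norm v"
proof -
  have "cmod (u \<cdot> v) \<le> (\<Sum>i\<in>UNIV. \<bar>cmod (u $ i)\<bar> * \<bar>cmod (v $ i)\<bar>)"
    unfolding cdot_def by (rule order_trans[OF norm_sum]) (simp add: norm_mult)
  also have "\<dots> \<le> norm u * norm v"
    unfolding norm_vec_def by (rule L2_set_mult_ineq)
  finally show ?thesis .
qed

lemma cinner_conv_cdot: "\<langle>u, v\<rangle> = u \<cdot> (\<chi> i. cnj (v $ i))"
  by (simp add: cdot_def cinner_def)

lemma norm_cinner_le: "cmod \<langle>u, v\<rangle> \<le> norm u * norm v"
  using norm_cdot_le[of u "\<chi> i. cnj (v $ i)"] by (simp add: cinner_conv_cdot norm_vec_def)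

lemma bounded_bilinear_cdot [bounded_bilinear]:
  "bounded_bilinear ((\<cdot>) :: complex^'n::finite \<Rightarrow> complex^'n \<Rightarrow> complex)"
proof
  show "\<exists>K. \<forall>u v :: complex^'n. cmod (u \<cdot> v) \<le> norm u * norm v * K"
    by (rule exI[of _ 1]) (simp add: norm_cdot_le)
qed (auto simp: cdot_def algebra_simps sum.distrib scaleR_sum_right)

lemma bounded_bilinear_cinner [bounded_bilinear]:
  "bounded_bilinear (cinner :: complex^'n::finite \<Rightarrow> complex^'n \<Rightarrow> complex)"
proof
  show "\<exists>K. \<forall>u v :: complex^'n. cmod \<langle>u, v\<rangle> \<le> norm u * norm v * K"
    by (rule exI[of _ 1]) (simp add: norm_cinner_le)
qed (auto simp: cinner_def algebra_simps sum.distrib scaleR_sum_right)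

interpretation cdot: bounded_bilinear "(\<cdot>) :: complex^'n::finite \<Rightarrow> complex^'n \<Rightarrow> complex"
  by (rule bounded_bilinear_cdot)

interpretation cinner: bounded_bilinear "cinner :: complex^'n::finite \<Rightarrow> complex^'n \<Rightarrow> complex"
  by (rule bounded_bilinear_cinner)

declare cdot.zero_left [simp] cdot.zero_right [simp]
declare cinner.zero_left [simp] cinner.zero_right [simp]

lemma cdot_scale [simp]: "(c *s u) \<cdot> v = c * (u \<cdot> v)" "u \<cdot> (c *s v) = c * (u \<cdot> v)"
  by (simp_all add: cdot_def sum_distrib_left algebra_simps)

lemma cinner_scale [simp]: "\<langle>c *s u, v\<rangle> = c * \<langle>u, v\<rangle>" "\<langle>u, c *s v\<rangle> = cnj c * \<langle>u, v\<rangle>"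
  by (simp_all add: cinner_def sum_distrib_left algebra_simps)

lemma cdot_commute: "u \<cdot> v = v \<cdot> u"
  by (simp add: cdot_def mult.commute)

lemma cdot_self: "v \<cdot> v = (\<Sum>i\<in>UNIV. (v $ i)\<^sup>2)"
  by (simp add: cdot_def power2_eq_square)

lemma cnj_cinner [simp]: "cnj \<langle>u, v\<rangle> = \<langle>v, u\<rangle>"
  by (simp add: cinner_def mult.commute)

lemma cinner_self: "\<langle>v, v\<rangle> = of_real ((norm v)\<^sup>2)"
  by (simp add: cinner_def norm_vec_def L2_set_def sum_nonneg complex_norm_square
      del: of_real_power)

lemma cdot_axis [simp]: "u \<cdot> axis k c = u $ k * c"
  by (simp add: cdot_def axis_def if_distrib cong: if_cong)

lemma matrix_vector_mult_nth: "(A *v z) $ i = A $ i \<cdot> z"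
  by (simp add: matrix_vector_mult_def cdot_def)

lemma cdot_matrix_vector_mult: "(A *v z) \<cdot> b = (transpose A *v b) \<cdot> z"
proof -
  have "(A *v z) \<cdot> b = (\<Sum>i\<in>UNIV. \<Sum>j\<in>UNIV. A $ i $ j * z $ j * b $ i)"
    by (simp add: cdot_def matrix_vector_mult_def sum_distrib_right)
  also have "\<dots> = (\<Sum>j\<in>UNIV. \<Sum>i\<in>UNIV. A $ i $ j * z $ j * b $ i)"
    by (rule sum.swap)
  also have "\<dots> = (transpose A *v b) \<cdot> z"
    by (simp add: cdot_def matrix_vector_mult_def transpose_def sum_distrib_left algebra_simps)
  finally show ?thesis .
qed

lemma isotropic_vector_exists:
  fixes L :: "complex^'n::finite \<Rightarrow> complex^'m::finite"
  assumes card: "CARD('n) \<ge> 2"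
    and add: "\<And>u v. L (u + v) = L u + L v" and scale: "\<And>c v. L (c *s v) = c *s L v"
  obtains v where "v \<noteq> 0" "L v \<cdot> L v = 0"
proof -
  obtain j1 j2 :: 'n where j: "j1 \<noteq> j2"
    using card by (metis UNIV_I card_le_Suc0_iff_eq finite not_less_eq_eq numeral_2_eq_2)
  let ?u = "axis j1 1 :: complex^'n" and ?w = "axis j2 1 :: complex^'n"
  define \<alpha> \<beta> \<gamma> where "\<alpha> = L ?u \<cdot> L ?u" and "\<beta> = L ?u \<cdot> L ?w" and "\<gamma> = L ?w \<cdot> L ?w"
  show ?thesis
  proof (cases "\<alpha> = 0")
    case True
    then show ?thesis by (intro that[of ?u]) (simp_all add: \<alpha>_def)
  next
    case False
    define s where "s = (csqrt (\<beta>\<^sup>2 - \<alpha> * \<gamma>) - \<beta>) / \<alpha>"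
    let ?v = "s *s ?u + ?w"
    have "L ?v \<cdot> L ?v = \<alpha> * s\<^sup>2 + 2 * \<beta> * s + \<gamma>"
      by (simp add: add scale cdot.add_left cdot.add_right cdot_commute[of "L ?w" "L ?u"]
          \<alpha>_def \<beta>_def \<gamma>_def power2_eq_square algebra_simps)
    also have "\<dots> = ((\<alpha> * s + \<beta>)\<^sup>2 - (\<beta>\<^sup>2 - \<alpha> * \<gamma>)) / \<alpha>"
      using False by (simp add: field_simps power2_eq_square)
    also have "\<alpha> * s + \<beta> = csqrt (\<beta>\<^sup>2 - \<alpha> * \<gamma>)" using False by (simp add: s_def)
    finally have "L ?v \<cdot> L ?v = 0" by simp
    moreover have "?v $ j2 = 1" using j by (simp add: axis_def)
    then have "?v \<noteq> 0" by (metis zero_index zero_neq_one)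
    ultimately show ?thesis using that by blast
  qed
qed

lemma rank_one_gram:
  assumes gram: "\<And>z w. z \<in> S \<Longrightarrow> w \<in> S \<Longrightarrow> \<langle>G z, G w\<rangle> = g z * cnj (g w)"
    and w: "w \<in> S" "g w \<noteq> 0"
  defines "b \<equiv> (1 / g w) *s G w"
  shows "\<langle>b, b\<rangle> = 1" and "z \<in> S \<Longrightarrow> G z = g z *s b"
proof -
  show bb: "\<langle>b, b\<rangle> = 1"
    using gram[OF w(1) w(1)] w(2) by (simp add: b_def)
  assume z: "z \<in> S"
  have Gb: "\<langle>G z, b\<rangle> = g z"
    using gram[OF z w(1)] w(2) by (simp add: b_def)
  then have bG: "\<langle>b, G z\<rangle> = cnj (g z)"
    by (metis cnj_cinner)
  have "\<langle>G z - g z *s b, G z - g z *s b\<rangle> = 0"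
    using gram[OF z z] by (simp add: cinner.diff_left cinner.diff_right Gb bG bb)
  then show "G z = g z *s b" by (simp add: cinner_self)
qed

section \<open>Polynomials in several variables\<close>

lemma poly_mapping_sum_monomials:
  fixes p :: "'a \<Rightarrow>\<^sub>0 'b::comm_monoid_add"
  shows "(\<Sum>a\<in>Poly_Mapping.keys p. Poly_Mapping.single a (Poly_Mapping.lookup p a)) = p"
  by (rule poly_mapping_eqI)
     (auto simp: lookup_sum lookup_single when_def in_keys_iff)

definition mconst :: "complex \<Rightarrow> 'n::finite mpoly" where
  "mconst c = Poly_Mapping.single 0 c"

definition mvar :: "'n::finite \<Rightarrow> 'n mpoly" where
  "mvar j = Poly_Mapping.single (Poly_Mapping.single j 1) 1"

definition mono_eval :: "('n::finite \<Rightarrow>\<^sub>0 nat) \<Rightarrow> complex^'n \<Rightarrow> complex" where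
  "mono_eval a z = (\<Prod>j\<in>UNIV. (z $ j) ^ Poly_Mapping.lookup a j)"

lemma mono_eval_0 [simp]: "mono_eval 0 z = 1"
  by (simp add: mono_eval_def)

lemma mono_eval_add: "mono_eval (a + b) z = mono_eval a z * mono_eval b z"
  by (simp add: mono_eval_def lookup_add power_add prod.distrib)

lemma mpeval_superset:
  assumes "finite S" "Poly_Mapping.keys p \<subseteq> S"
  shows "mpeval p z = (\<Sum>a\<in>S. Poly_Mapping.lookup p a * mono_eval a z)"
  unfolding mpeval_def mono_eval_def[symmetric]
  using assms by (intro sum.mono_neutral_left) (auto simp: in_keys_iff)

lemma mpeval_single [simp]: "mpeval (Poly_Mapping.single a c) z = c * mono_eval a z"
  by (subst mpeval_superset[where S="{a}"]) auto

lemma mpeval_0 [simp]: "mpeval 0 z = 0"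
  by (simp add: mpeval_def)

lemma mpeval_add [simp]: "mpeval (p + q) z = mpeval p z + mpeval q z"
proof -
  let ?S = "Poly_Mapping.keys p \<union> Poly_Mapping.keys q"
  have "Poly_Mapping.keys (p + q) \<subseteq> ?S" by (rule Poly_Mapping.keys_add)
  then show ?thesis
    by (subst (1 2 3) mpeval_superset[where S="?S"])
       (auto simp: lookup_add algebra_simps sum.distrib)
qed

lemma mpeval_uminus [simp]: "mpeval (- p) z = - mpeval p z"
  using mpeval_add[of p "- p" z] by (simp add: eq_neg_iff_add_eq_0 add.commute)

lemma mpeval_diff [simp]: "mpeval (p - q) z = mpeval p z - mpeval q z"
  using mpeval_add[of "p" "- q" z] by simp

lemma mpoly_single_induct [case_names single add]:
  fixes p :: "'n::finite mpoly"
  assumes single: "\<And>a c. Q (Poly_Mapping.single a c)"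
    and add: "\<And>p q. Q p \<Longrightarrow> Q q \<Longrightarrow> Q (p + q)"
  shows "Q p"
proof -
  have "Q 0" using single[of 0 0] by simp
  have "Q (\<Sum>a\<in>S. Poly_Mapping.single a (Poly_Mapping.lookup p a))" if "finite S" for S
    using that by induction (auto simp: \<open>Q 0\<close> intro: single add)
  then have "Q (\<Sum>a\<in>Poly_Mapping.keys p. Poly_Mapping.single a (Poly_Mapping.lookup p a))"
    by simp
  then show ?thesis by (simp add: poly_mapping_sum_monomials)
qed

lemma mpeval_mult [simp]: "mpeval (p * q) z = mpeval p z * mpeval q z"
proof (induction p rule: mpoly_single_induct)
  case (single a c)
  show ?case
    by (induction q rule: mpoly_single_induct)
       (auto simp: mult_single mono_eval_add algebra_simps)
qed (auto simp: algebra_simps)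

lemma mpeval_const [simp]: "mpeval (mconst c) z = c"
  by (simp add: mconst_def)

lemma mconst_1: "mconst 1 = 1"
  by (simp add: mconst_def)

lemma mpeval_1 [simp]: "mpeval 1 z = 1"
  using mpeval_const[of 1 z] by (simp add: mconst_1)

lemma mpeval_var [simp]: "mpeval (mvar j) z = z $ j"
proof -
  have "mono_eval (Poly_Mapping.single j 1) z = (\<Prod>i\<in>UNIV. if i = j then z $ i else 1)"
    unfolding mono_eval_def by (intro prod.cong) (auto simp: lookup_single when_def)
  then show ?thesis by (simp add: mvar_def)
qed

lemma mpeval_sum [simp]: "mpeval (\<Sum>i\<in>S. p i) z = (\<Sum>i\<in>S. mpeval (p i) z)"
  by (induction S rule: infinite_finite_induct) auto

lemma continuous_on_mpeval: "continuous_on S (mpeval p)"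
  unfolding mpeval_def by (intro continuous_intros)

lemma mpoly_induct [case_names const var add mult]:
  fixes p :: "'n::finite mpoly"
  assumes const: "\<And>c. Q (mconst c)" and var: "\<And>j. Q (mvar j)"
    and add: "\<And>p q. Q p \<Longrightarrow> Q q \<Longrightarrow> Q (p + q)"
    and mult: "\<And>p q. Q p \<Longrightarrow> Q q \<Longrightarrow> Q (p * q)"
  shows "Q p"
proof (induction p rule: mpoly_single_induct)
  case (single a c)
  have one: "Q 1" using const[of 1] by (simp add: mconst_1)
  have var_power: "Q (Poly_Mapping.single (Poly_Mapping.single j k) 1)" for j k
  proof (induction k)
    case (Suc k)
    have "Poly_Mapping.single (Poly_Mapping.single j (Suc k)) (1::complex)
      = mvar j * Poly_Mapping.single (Poly_Mapping.single j k) 1"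
      by (simp add: mvar_def mult_single flip: single_add)
    then show ?case using mult[OF var Suc] by simp
  qed (use one in simp)
  have "Q (Poly_Mapping.single (\<Sum>j\<in>S. Poly_Mapping.single j (Poly_Mapping.lookup a j)) 1)"
    if "finite S" for S
    using that
  proof induction
    case (insert j S)
    then show ?case using mult[OF var_power[of j "Poly_Mapping.lookup a j"] insert.IH]
      by (simp add: mult_single)
  qed (use one in simp)
  from this[of "Poly_Mapping.keys a"]
  have "Q (Poly_Mapping.single a 1)" by (simp add: poly_mapping_sum_monomials)
  from mult[OF const[of c] this] show ?case by (simp add: mconst_def mult_single)
qed (rule add)

lemma mpeval_line: "\<exists>q. \<forall>t. mpeval p (u + t *s v) = poly q t"
proof (induction p rule: mpoly_induct)
  case (const c) then show ?case by (intro exI[of _ "[:c:]"]) auto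
next
  case (var j) then show ?case by (intro exI[of _ "[:u $ j, v $ j:]"]) (auto simp: algebra_simps)
next
  case (add p q) then show ?case by (metis mpeval_add poly_add)
next
  case (mult p q) then show ?case by (metis mpeval_mult poly_mult)
qed

lemma mpeval_line_through_0: "\<exists>q. \<forall>t. mpeval p (t *s v) = poly q t"
  using mpeval_line[of p 0 v] by simp

subsection \<open>Polynomial identities\<close>

lemma dedekind_independence_of_characters:
  fixes \<phi> :: "'i \<Rightarrow> 'a::monoid_mult \<Rightarrow> 'k::field"
  assumes "finite S" and "\<And>a. a \<in> S \<Longrightarrow> \<phi> a 1 = 1"
    and "\<And>a x y. a \<in> S \<Longrightarrow> \<phi> a (x * y) = \<phi> a x * \<phi> a y"
    and "inj_on \<phi> S" and "\<And>x. (\<Sum>a\<in>S. c a * \<phi> a x) = 0"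
  shows "\<forall>a\<in>S. c a = 0"
  using assms
proof (induction S arbitrary: c)
  case (insert b S)
  have "c a = 0" if a: "a \<in> S" for a
  proof -
    have "a \<noteq> b" using a insert.hyps by auto
    then have "\<phi> a \<noteq> \<phi> b"
      using inj_onD[OF insert.prems(3), of a b] a by blast
    then obtain y where y: "\<phi> a y \<noteq> \<phi> b y" by blast
    have "(\<Sum>a\<in>S. (c a * (\<phi> a y - \<phi> b y)) * \<phi> a x) = 0" for x
    proof -
      have "(\<Sum>a\<in>S. (c a * (\<phi> a y - \<phi> b y)) * \<phi> a x)
        = (\<Sum>a\<in>insert b S. c a * \<phi> a (y * x)) - \<phi> b y * (\<Sum>a\<in>insert b S. c a * \<phi> a x)"
        using insert.hyps insert.prems(2)
        by (simp add: algebra_simps sum_distrib_left sum_subtractf)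
      then show ?thesis using insert.prems(4) by simp
    qed
    then have "\<forall>a\<in>S. c a * (\<phi> a y - \<phi> b y) = 0"
      using insert.prems by (intro insert.IH) auto
    then show ?thesis using a y by auto
  qed
  moreover from this have "c b = 0"
    using insert.prems(1)[of b] insert.prems(4)[of 1] insert.hyps by simp
  ultimately show ?case by simp
qed simp

lemma inj_mono_eval: "inj (mono_eval :: ('n::finite \<Rightarrow>\<^sub>0 nat) \<Rightarrow> _)"
proof (rule injI)
  fix a b :: "'n \<Rightarrow>\<^sub>0 nat" assume eq: "mono_eval a = mono_eval b"
  show "a = b"
  proof (rule poly_mapping_eqI)
    fix j
    define z :: "complex^'n" where "z = (\<chi> i. if i = j then 2 else 1)"
    have "mono_eval c z = 2 ^ Poly_Mapping.lookup c j" for c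
      by (simp add: mono_eval_def z_def if_distrib[of "\<lambda>x. x ^ _"] cong: if_cong)
    from this[of a] this[of b]
    have "(2::complex) ^ Poly_Mapping.lookup a j = 2 ^ Poly_Mapping.lookup b j"
      by (simp add: eq)
    from arg_cong[OF this, of cmod]
    have "(2::real) ^ Poly_Mapping.lookup a j = 2 ^ Poly_Mapping.lookup b j"
      by (simp add: norm_power)
    then show "Poly_Mapping.lookup a j = Poly_Mapping.lookup b j" by simp
  qed
qed

lemma mpoly_nonzero_somewhere:
  assumes "p \<noteq> 0" shows "\<exists>z. mpeval p z \<noteq> 0"
proof (rule ccontr)
  assume "\<not> ?thesis"
  then have vanish: "(\<Sum>a\<in>Poly_Mapping.keys p. Poly_Mapping.lookup p a * mono_eval a z) = 0" for z
    using mpeval_superset[OF finite_keys subset_refl, of p z] by simp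
  have "\<forall>a\<in>Poly_Mapping.keys p. Poly_Mapping.lookup p a = 0"
  proof (rule dedekind_independence_of_characters[OF finite_keys _ _ _ vanish])
    show "inj_on mono_eval (Poly_Mapping.keys p)"
      by (rule inj_on_subset[OF inj_mono_eval]) simp
  qed (simp_all add: mono_eval_def power_mult_distrib prod.distrib)
  then have "Poly_Mapping.keys p = {}" unfolding in_keys_iff by blast
  then show False using assms by simp
qed

lemma poly_eqI_open:
  fixes p q :: "'a::{real_normed_field, perfect_space} poly"
  assumes "open S" "S \<noteq> {}" "\<And>t. t \<in> S \<Longrightarrow> poly p t = poly q t"
  shows "p = q"
proof (rule ccontr)
  assume "p \<noteq> q"
  then have "finite {t. poly (p - q) t = 0}" by (intro poly_roots_finite) simp
  moreover have "S \<subseteq> {t. poly (p - q) t = 0}" using assms(3) by auto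
  ultimately show False using finite_imp_not_open assms(1,2) finite_subset by blast
qed

lemma bounded_linear_scalar_vector:
  "bounded_linear (\<lambda>h. h *s (b :: 'a::real_normed_field^'n::finite))"
  by (intro bounded_linear_intro[of _ "norm b"])
     (auto simp: vec_eq_iff algebra_simps norm_vector_scalar_mult)

lemma continuous_on_line [continuous_intros]:
  "continuous_on S f \<Longrightarrow> continuous_on S (\<lambda>x. a + f x *s (b :: complex^'n::finite))"
  for f :: "'a::topological_space \<Rightarrow> complex"
  by (intro continuous_intros bounded_linear.continuous_on[OF bounded_linear_scalar_vector])

lemma open_line_vimage: "open S \<Longrightarrow> open {t::complex. a + t *s b \<in> S}"
  using open_vimage[of S "\<lambda>t. a + t *s b"] by (simp add: vimage_def continuous_intros)

lemma mpoly_nonzero_in_open: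
  assumes "p \<noteq> 0" "open S" "S \<noteq> {}"
  shows "\<exists>z\<in>S. mpeval p z \<noteq> 0"
proof (rule ccontr)
  assume vanish: "\<not> ?thesis"
  obtain z0 where z0: "z0 \<in> S" using assms(3) by blast
  obtain z1 where z1: "mpeval p z1 \<noteq> 0" using mpoly_nonzero_somewhere[OF assms(1)] by blast
  obtain q where q: "\<And>t. mpeval p (z0 + t *s (z1 - z0)) = poly q t"
    using mpeval_line by blast
  have "q = 0"
  proof (rule poly_eqI_open[OF open_line_vimage[OF assms(2), of z0 "z1 - z0"]])
    have "0 \<in> {t. z0 + t *s (z1 - z0) \<in> S}" using z0 by simp
    then show "{t. z0 + t *s (z1 - z0) \<in> S} \<noteq> {}" by blast
    show "poly q t = poly 0 t" if "t \<in> {t. z0 + t *s (z1 - z0) \<in> S}" for t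
      using that vanish q[of t] by simp
  qed
  then show False using q[of 1] z1 by simp
qed

lemma mpoly_eqI_open:
  assumes "open S" "S \<noteq> {}" "\<And>z. z \<in> S \<Longrightarrow> mpeval p z = mpeval q z"
  shows "p = q"
  using mpoly_nonzero_in_open[of "p - q" S] assms by force

lemma mpoly_eqI: "(\<And>z. mpeval p z = mpeval q z) \<Longrightarrow> p = q"
  by (rule mpoly_eqI_open[of UNIV]) auto

text \<open>The line through a nonzero of \<open>p\<close> and a nonzero of \<open>q\<close> reduces this to one variable.\<close>
lemma mpoly_mult_eq_0_iff:
  fixes p q :: "'n::finite mpoly"
  shows "p * q = 0 \<longleftrightarrow> p = 0 \<or> q = 0"
proof
  assume prod: "p * q = 0"
  show "p = 0 \<or> q = 0"
  proof (rule ccontr)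
    assume "\<not> ?thesis"
    then obtain u v where u: "mpeval p u \<noteq> 0" and v: "mpeval q v \<noteq> 0"
      using mpoly_nonzero_somewhere by blast
    obtain f g where f: "\<And>t. mpeval p (u + t *s (v - u)) = poly f t"
      and g: "\<And>t. mpeval q (u + t *s (v - u)) = poly g t"
      using mpeval_line by meson
    have "poly (f * g) t = mpeval (p * q) (u + t *s (v - u))" for t
      by (simp only: f g poly_mult mpeval_mult)
    then have "f * g = 0" by (intro poly_ext) (simp only: prod mpeval_0 poly_0)
    then have "f = 0 \<or> g = 0" by simp
    then show False using f[of 0] g[of 1] u v by auto
  qed
qed auto

lemma mpoly_mult_left_cancel:
  fixes p q r :: "'n::finite mpoly"
  assumes "p \<noteq> 0" "p * q = p * r" shows "q = r"
  using mpoly_mult_eq_0_iff[of p "q - r"] assms by (simp add: right_diff_distrib)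

lemma mpoly_unit_const:
  fixes p :: "'n::finite mpoly"
  assumes "p dvd 1" shows "\<exists>c. c \<noteq> 0 \<and> p = mconst c"
proof -
  obtain s where s: "p * s = 1" using assms by (metis dvdE)
  have "mpeval p z = mpeval p 0" for z
  proof -
    obtain f g where f: "\<And>t. mpeval p (t *s z) = poly f t" and g: "\<And>t. mpeval s (t *s z) = poly g t"
      using mpeval_line_through_0 by meson
    have "poly (f * g) t = mpeval (p * s) (t *s z)" for t
      by (simp only: f g poly_mult mpeval_mult)
    then have "f * g = 1" by (intro poly_ext) (simp only: s mpeval_1 poly_1)
    then have "f dvd 1" by (metis dvd_triv_left)
    then obtain c where "f = [:c:]" using is_unit_poly_iff by blast
    then show ?thesis using f[of 1] f[of 0] by simp
  qed
  then have "p = mconst (mpeval p 0)" by (intro mpoly_eqI) simp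
  moreover have "mpeval p 0 \<noteq> 0" using s by (metis mpeval_1 mpeval_mult mult_zero_left zero_neq_one)
  ultimately show ?thesis by blast
qed

subsection \<open>Degrees\<close>

definition total_deg :: "('n::finite \<Rightarrow>\<^sub>0 nat) \<Rightarrow> nat" where
  "total_deg a = (\<Sum>j\<in>UNIV. Poly_Mapping.lookup a j)"

lemma mdeg_le_iff: "mdeg p \<le> d \<longleftrightarrow> (\<forall>a\<in>Poly_Mapping.keys p. total_deg a \<le> d)"
  unfolding mdeg_def total_deg_def by (subst Max_le_iff) auto

lemma mdeg_add_le: "mdeg p \<le> d \<Longrightarrow> mdeg q \<le> d \<Longrightarrow> mdeg (p + q) \<le> d"
  unfolding mdeg_le_iff using Poly_Mapping.keys_add[of p q] by auto

lemma mdeg_diff_le: "mdeg p \<le> d \<Longrightarrow> mdeg q \<le> d \<Longrightarrow> mdeg (p - q) \<le> d"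
  using mdeg_add_le[of p d "- q"] by (simp add: mdeg_def)

lemma mdeg_sum_le: "(\<And>i. i \<in> S \<Longrightarrow> mdeg (p i) \<le> d) \<Longrightarrow> mdeg (\<Sum>i\<in>S. p i) \<le> d"
  by (induction S rule: infinite_finite_induct) (auto intro: mdeg_add_le simp: mdeg_def[of 0])

lemma mdeg_mult_le:
  assumes p: "mdeg p \<le> d" and q: "mdeg q \<le> e"
  shows "mdeg (p * q) \<le> d + e"
  unfolding mdeg_le_iff
proof
  fix a assume "a \<in> Poly_Mapping.keys (p * q)"
  then obtain b c where "b \<in> Poly_Mapping.keys p" "c \<in> Poly_Mapping.keys q" "a = b + c"
    using keys_mult[of p q] by blast
  then show "total_deg a \<le> d + e" using p q
    by (auto simp: mdeg_le_iff total_deg_def lookup_add sum.distrib intro: add_mono)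
qed

lemma mdeg_const [simp]: "mdeg (mconst c) = 0"
  using mdeg_le_iff[of "mconst c" 0] by (auto simp: mconst_def total_deg_def split: if_splits)

lemma mdeg_1 [simp]: "mdeg 1 = 0"
  using mdeg_const[of 1] by (simp add: mconst_1)

lemma mdeg_var_le: "mdeg (mvar j :: 'n::finite mpoly) \<le> 1"
  by (auto simp: mdeg_le_iff mvar_def total_deg_def lookup_single when_def)

lemma mdeg_const_mult_le: "mdeg p \<le> d \<Longrightarrow> mdeg (mconst c * p) \<le> d"
  using mdeg_mult_le[of "mconst c" 0 p d] by simp

lemma rdeg_le_iff: "rdeg P R \<le> d \<longleftrightarrow> (\<forall>i. mdeg (P $ i) \<le> d) \<and> mdeg R \<le> d"
  unfolding rdeg_def by (subst max.bounded_iff, subst Max_le_iff) auto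

definition homogeneous :: "nat \<Rightarrow> 'n::finite mpoly \<Rightarrow> bool" where
  "homogeneous d p \<longleftrightarrow> (\<forall>t z. mpeval p (t *s z) = t ^ d * mpeval p z)"

lemma mpeval_ray_degree:
  "\<exists>q. degree q \<le> mdeg p \<and> (\<forall>t. mpeval p (t *s z) = poly q t)"
proof (intro exI conjI allI)
  let ?q = "\<Sum>a\<in>Poly_Mapping.keys p. monom (Poly_Mapping.lookup p a * mono_eval a z) (total_deg a)"
  show "degree ?q \<le> mdeg p"
    by (intro degree_sum_le)
       (auto intro: order_trans[OF degree_monom_le] mdeg_le_iff[THEN iffD1, rule_format])
  show "mpeval p (t *s z) = poly ?q t" for t
    by (simp add: mpeval_def poly_sum poly_monom mono_eval_def power_mult_distrib prod.distrib
        total_deg_def power_sum algebra_simps)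
qed

lemma homogeneous_le_mdeg:
  assumes "homogeneous d p" "p \<noteq> 0"
  shows "d \<le> mdeg p"
proof -
  obtain z where z: "mpeval p z \<noteq> 0" using mpoly_nonzero_somewhere[OF assms(2)] by blast
  obtain q where q: "degree q \<le> mdeg p" "\<And>t. mpeval p (t *s z) = poly q t"
    using mpeval_ray_degree by blast
  have "q = monom (mpeval p z) d"
    using assms(1) by (intro poly_ext) (simp add: homogeneous_def poly_monom flip: q(2))
  then show ?thesis using q(1) z by (simp add: degree_monom_eq)
qed

definition linear_form :: "complex^'n::finite \<Rightarrow> 'n mpoly" where
  "linear_form a = (\<Sum>j\<in>UNIV. mconst (a $ j) * mvar j)"

lemma mpeval_linear_form [simp]: "mpeval (linear_form a) z = a \<cdot> z"
  by (simp add: linear_form_def cdot_def)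

lemma mdeg_linear_form_le: "mdeg (linear_form a) \<le> 1"
  unfolding linear_form_def by (intro mdeg_sum_le mdeg_const_mult_le mdeg_var_le)

lemma linear_form_eq_0_iff: "linear_form a = 0 \<longleftrightarrow> a = 0"
proof
  assume "linear_form a = 0"
  then have "a $ j = 0" for j
    using mpeval_linear_form[of a "axis j 1"] by simp
  then show "a = 0" by (simp add: vec_eq_iff)
next
  assume "a = 0"
  then show "linear_form a = 0" by (intro mpoly_eqI) (simp add: cdot_def)
qed

subsection \<open>The prime \<open>1 - l\<close>\<close>

text \<open>Solving \<open>l = 1\<close> for the coordinate \<open>z\<^sub>j\<close> gives a remainder that does not see \<open>z\<^sub>j\<close>.\<close>
lemma one_minus_linear_form_dvd_if_vanishes:
  fixes f :: "'n::finite mpoly"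
  assumes j: "a $ j \<noteq> 0"
    and vanish: "\<And>z. a \<cdot> z = 1 \<Longrightarrow> mpeval f z = 0"
  shows "(1 - linear_form a) dvd f"
proof -
  let ?D = "1 - linear_form a"
  define y where "y = mvar j + mconst (1 / a $ j) * ?D"
  define s where "s z = z + ((1 - a \<cdot> z) / a $ j) *s axis j 1" for z
  have "\<exists>g. ?D dvd f - g \<and> (\<forall>z. mpeval g z = mpeval f (s z))"
  proof (induction f rule: mpoly_induct)
    case (const c) then show ?case by (intro exI[of _ "mconst c"]) auto
  next
    case (var i)
    show ?case
      by (intro exI[of _ "if i = j then y else mvar i"]) (auto simp: s_def y_def axis_def)
  next
    case (add p q)
    then obtain g h where g: "?D dvd p - g" "\<And>z. mpeval g z = mpeval p (s z)"
      and h: "?D dvd q - h" "\<And>z. mpeval h z = mpeval q (s z)" by blast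
    have "?D dvd (p - g) + (q - h)" using g h by (intro dvd_add)
    then show ?case using g h by (intro exI[of _ "g + h"]) (auto simp: algebra_simps)
  next
    case (mult p q)
    then obtain g h where g: "?D dvd p - g" "\<And>z. mpeval g z = mpeval p (s z)"
      and h: "?D dvd q - h" "\<And>z. mpeval h z = mpeval q (s z)" by blast
    have "?D dvd (p - g) * q + g * (q - h)" using g h by (intro dvd_add) auto
    then show ?case using g h by (intro exI[of _ "g * h"]) (auto simp: algebra_simps)
  qed
  then obtain g where g: "?D dvd f - g" "\<And>z. mpeval g z = mpeval f (s z)" by blast
  have "a \<cdot> s z = 1" for z
    using j by (simp add: s_def cdot.add_right)
  then have "g = 0" using g(2) vanish by (intro mpoly_eqI) simp
  then show ?thesis using g by simp
qed

lemma one_minus_linear_form_dvd_mult: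
  fixes f g :: "'n::finite mpoly"
  assumes "(1 - linear_form a) dvd f * g"
  shows "(1 - linear_form a) dvd f \<or> (1 - linear_form a) dvd g"
proof (cases "a = 0")
  case False
  then obtain j where j: "a $ j \<noteq> 0" by (auto simp: vec_eq_iff)
  show ?thesis
  proof (rule ccontr)
    assume "\<not> ?thesis"
    then obtain u v where u: "a \<cdot> u = 1" "mpeval f u \<noteq> 0" and v: "a \<cdot> v = 1" "mpeval g v \<noteq> 0"
      using one_minus_linear_form_dvd_if_vanishes[OF j] by blast
    obtain p q where p: "\<And>t. mpeval f (u + t *s (v - u)) = poly p t"
      and q: "\<And>t. mpeval g (u + t *s (v - u)) = poly q t"
      using mpeval_line by meson
    have "mpeval (f * g) (u + t *s (v - u)) = 0" for t
    proof -
      have "a \<cdot> (u + t *s (v - u)) = 1"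
        using u v by (simp add: cdot.add_right cdot.diff_right del: vector_ssub_ldistrib)
      then have "mpeval (1 - linear_form a) (u + t *s (v - u)) = 0" by simp
      then show ?thesis using assms by (metis dvdE mpeval_mult mult_zero_left)
    qed
    then have "p * q = 0" by (intro poly_ext) (simp only: mpeval_mult p q poly_mult poly_0)
    then have "p = 0 \<or> q = 0" by simp
    then show False using p[of 0] q[of 1] u v by auto
  qed
qed (simp add: linear_form_eq_0_iff[THEN iffD2])

lemma one_minus_linear_form_dvd_homogeneous:
  assumes "homogeneous d q" "q \<noteq> 0" "(1 - linear_form a) dvd q"
  shows "a = 0"
proof (rule ccontr)
  assume "a \<noteq> 0"
  then have "linear_form a * q \<noteq> 0"
    using assms(2) by (simp add: linear_form_eq_0_iff mpoly_mult_eq_0_iff)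
  then obtain u where "mpeval (linear_form a * q) u \<noteq> 0"
    using mpoly_nonzero_somewhere by blast
  then have u: "a \<cdot> u \<noteq> 0" "mpeval q u \<noteq> 0" by simp_all
  define w where "w = (1 / (a \<cdot> u)) *s u"
  have "mpeval (1 - linear_form a) w = 0" using u by (simp add: w_def)
  then have "mpeval q w = 0" using assms(3) by (metis dvdE mpeval_mult mult_zero_left)
  then show False using assms(1) u by (simp add: w_def homogeneous_def)
qed

lemma one_minus_linear_form_dvd_cancel_homogeneous:
  assumes "homogeneous d q" "q \<noteq> 0" "(1 - linear_form a) dvd q * f"
  shows "(1 - linear_form a) dvd f"
  using one_minus_linear_form_dvd_mult[OF assms(3)]
    one_minus_linear_form_dvd_homogeneous[OF assms(1,2)]
  by (auto simp: linear_form_eq_0_iff[THEN iffD2])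

section \<open>Polarization\<close>

definition gateaux_holomorphic_on ::
  "(complex^'n::finite \<Rightarrow> complex) \<Rightarrow> (complex^'n) set \<Rightarrow> bool" where
  "gateaux_holomorphic_on f D \<longleftrightarrow>
     (\<forall>a b. (\<lambda>t. f (a + t *s b)) holomorphic_on {t. a + t *s b \<in> D})"

text \<open>Holomorphic in the first and antiholomorphic in the second variable, tested along complex
  lines.\<close>
definition sesquiholomorphic_on ::
  "(complex^'n::finite \<Rightarrow> complex^'n \<Rightarrow> complex) \<Rightarrow> (complex^'n) set \<Rightarrow> (complex^'n) set \<Rightarrow> bool" where
  "sesquiholomorphic_on K D E \<longleftrightarrow> (\<forall>a b c d.
     (\<lambda>t. K (a + t *s b) (c + cnj t *s d)) holomorphic_on {t. a + t *s b \<in> D \<and> c + cnj t *s d \<in> E})"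

lemma gateaux_holomorphic_on_subset:
  "gateaux_holomorphic_on f D \<Longrightarrow> E \<subseteq> D \<Longrightarrow> gateaux_holomorphic_on f E"
  unfolding gateaux_holomorphic_on_def by (meson Collect_mono holomorphic_on_subset subsetD)

lemma sesquiholomorphic_on_subset:
  assumes "sesquiholomorphic_on K D E" "D' \<subseteq> D" "E' \<subseteq> E"
  shows "sesquiholomorphic_on K D' E'"
  unfolding sesquiholomorphic_on_def
proof (intro allI)
  fix a b c d
  have "(\<lambda>t. K (a + t *s b) (c + cnj t *s d))
      holomorphic_on {t. a + t *s b \<in> D \<and> c + cnj t *s d \<in> E}"
    using assms(1) by (simp add: sesquiholomorphic_on_def)
  then show "(\<lambda>t. K (a + t *s b) (c + cnj t *s d))
      holomorphic_on {t. a + t *s b \<in> D' \<and> c + cnj t *s d \<in> E'}"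
    by (rule holomorphic_on_subset) (use assms(2,3) in blast)
qed

lemma has_field_derivative_line:
  assumes "(f has_derivative (\<cdot>) d) (at (a + x *s b))"
  shows "((\<lambda>x. f (a + x *s b)) has_field_derivative d \<cdot> b) (at x)"
proof -
  have "((\<lambda>x::complex. a + x *s b) has_derivative (\<lambda>h. 0 + h *s b)) (at x)"
    by (intro has_derivative_add has_derivative_const bounded_linear_imp_has_derivative
        bounded_linear_scalar_vector)
  from has_derivative_compose[OF this, of f "(\<cdot>) d"] assms
  have "((\<lambda>x. f (a + x *s b)) has_derivative (\<lambda>h. d \<cdot> (h *s b))) (at x)" by simp
  then show ?thesis by (simp add: has_field_derivative_def mult.commute[of _ "d \<cdot> b"])
qed

lemma gateaux_holomorphic_onI:
  assumes "\<And>z. z \<in> D \<Longrightarrow> \<exists>d. (f has_derivative (\<cdot>) d) (at z)"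
  shows "gateaux_holomorphic_on f D"
  unfolding gateaux_holomorphic_on_def
proof (intro allI holomorphic_onI)
  fix a b :: "complex^'a" and x assume "x \<in> {t. a + t *s b \<in> D}"
  then obtain d where "(f has_derivative (\<cdot>) d) (at (a + x *s b))"
    using assms by blast
  then have "((\<lambda>x. f (a + x *s b)) has_field_derivative d \<cdot> b) (at x)"
    by (rule has_field_derivative_line)
  then show "(\<lambda>t. f (a + t *s b)) field_differentiable (at x within {t. a + t *s b \<in> D})"
    using field_differentiable_at_within field_differentiable_def by blast
qed

lemma gateaux_holomorphic_on_nth: "gateaux_holomorphic_on (\<lambda>z. z $ j) D"
  by (auto simp: gateaux_holomorphic_on_def intro!: holomorphic_intros)

lemma sesquiholomorphic_on_left:
  assumes "gateaux_holomorphic_on f D" shows "sesquiholomorphic_on (\<lambda>z w. f z) D E"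
  using assms unfolding gateaux_holomorphic_on_def sesquiholomorphic_on_def
  by (auto intro: holomorphic_on_subset)

lemma sesquiholomorphic_on_cnj_right:
  assumes f: "gateaux_holomorphic_on f E" and "open E"
  shows "sesquiholomorphic_on (\<lambda>z w. cnj (f w)) D E"
  unfolding sesquiholomorphic_on_def
proof (intro allI)
  fix a b c d :: "complex^'a"
  let ?S = "{t. c + t *s d \<in> E}"
  have "cnj ` (cnj ` ?S) = ?S" by (simp add: image_image)
  moreover have "open (cnj ` ?S)"
    unfolding image_cnj_conv_vimage_cnj
    by (intro open_vimage open_line_vimage \<open>open E\<close> continuous_intros)
  ultimately have "cnj \<circ> (\<lambda>t. f (c + t *s d)) \<circ> cnj holomorphic_on cnj ` ?S"
    using f by (intro holomorphic_on_compose_cnj_cnj) (auto simp: gateaux_holomorphic_on_def)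
  moreover have "{t. a + t *s b \<in> D \<and> c + cnj t *s d \<in> E} \<subseteq> cnj ` ?S"
    unfolding image_cnj_conv_vimage_cnj by auto
  ultimately show "(\<lambda>t. cnj (f (c + cnj t *s d)))
      holomorphic_on {t. a + t *s b \<in> D \<and> c + cnj t *s d \<in> E}"
    by (auto simp: o_def intro: holomorphic_on_subset)
qed

lemma sesquiholomorphic_on_const: "sesquiholomorphic_on (\<lambda>z w. c) D E"
  by (simp add: sesquiholomorphic_on_def)

lemma sesquiholomorphic_on_add:
  "sesquiholomorphic_on K D E \<Longrightarrow> sesquiholomorphic_on K' D E \<Longrightarrow>
   sesquiholomorphic_on (\<lambda>z w. K z w + K' z w) D E"
  unfolding sesquiholomorphic_on_def by (intro allI holomorphic_on_add) auto

lemma sesquiholomorphic_on_minus: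
  "sesquiholomorphic_on K D E \<Longrightarrow> sesquiholomorphic_on (\<lambda>z w. - K z w) D E"
  unfolding sesquiholomorphic_on_def by (intro allI holomorphic_on_minus) auto

lemma sesquiholomorphic_on_diff:
  "sesquiholomorphic_on K D E \<Longrightarrow> sesquiholomorphic_on K' D E \<Longrightarrow>
   sesquiholomorphic_on (\<lambda>z w. K z w - K' z w) D E"
  unfolding sesquiholomorphic_on_def by (intro allI holomorphic_on_diff) auto

lemma sesquiholomorphic_on_mult:
  "sesquiholomorphic_on K D E \<Longrightarrow> sesquiholomorphic_on K' D E \<Longrightarrow>
   sesquiholomorphic_on (\<lambda>z w. K z w * K' z w) D E"
  unfolding sesquiholomorphic_on_def by (intro allI holomorphic_on_mult) auto

lemma sesquiholomorphic_on_sum: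
  "(\<And>i. i \<in> I \<Longrightarrow> sesquiholomorphic_on (K i) D E) \<Longrightarrow>
   sesquiholomorphic_on (\<lambda>z w. \<Sum>i\<in>I. K i z w) D E"
  unfolding sesquiholomorphic_on_def by (intro allI holomorphic_on_sum) auto

lemmas sesquiholomorphic_intros = sesquiholomorphic_on_const sesquiholomorphic_on_add
  sesquiholomorphic_on_minus sesquiholomorphic_on_diff sesquiholomorphic_on_mult
  sesquiholomorphic_on_sum

lemma holomorphic_eq_0_if_eq_0_on_reals:
  assumes f: "f holomorphic_on S" and S: "open S" "connected S" "0 \<in> S"
    and zero: "\<And>t::real. of_real t \<in> S \<Longrightarrow> f (of_real t) = 0"
    and "w \<in> S"
  shows "f w = 0"
proof -
  obtain s where s: "s > 0" "ball 0 s \<subseteq> S" using S openE by blast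
  have "(0::complex) islimpt of_real ` {0<..<s}"
    unfolding islimpt_approachable
  proof (intro allI impI)
    fix e :: real assume "e > 0"
    with s(1) show "\<exists>x'\<in>complex_of_real ` {0<..<s}. x' \<noteq> 0 \<and> dist x' 0 < e"
      by (intro bexI[of _ "complex_of_real (min e s / 2)"] conjI imageI) auto
  qed
  moreover have "of_real ` {0<..<s} \<subseteq> S" using s(2) by auto
  moreover from this have "f x = 0" if "x \<in> of_real ` {0<..<s}" for x
    using that zero by blast
  ultimately show ?thesis
    using analytic_continuation[OF f S(1,2), of "of_real ` {0<..<s}" 0] S(3) \<open>w \<in> S\<close> by blast
qed

lemma convex_line_vimage:
  assumes "convex S" shows "convex {t::complex. a + t *s b \<in> S}"
proof (rule convexI)
  fix x y :: complex and u v :: real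
  assume xy: "x \<in> {t. a + t *s b \<in> S}" "y \<in> {t. a + t *s b \<in> S}" "0 \<le> u" "0 \<le> v" "u + v = 1"
  have "a + (u *\<^sub>R x + v *\<^sub>R y) *s b = (u + v) *\<^sub>R a + (u *\<^sub>R x + v *\<^sub>R y) *s b"
    using xy(5) by simp
  also have "\<dots> = u *\<^sub>R (a + x *s b) + v *\<^sub>R (a + y *s b)"
    by (simp add: vec_eq_iff algebra_simps)
  finally show "u *\<^sub>R x + v *\<^sub>R y \<in> {t. a + t *s b \<in> S}"
    using convexD[OF assms, of "a + x *s b" "a + y *s b" u v] xy by simp
qed

lemma convex_cnj_line_vimage: "convex S \<Longrightarrow> convex {t. a + cnj t *s b \<in> S}"
  using convex_linear_vimage[OF bounded_linear.linear[OF bounded_linear_cnj]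
      convex_line_vimage[of S a b]] by (simp add: vimage_def)

lemma open_cnj_line_vimage: "open S \<Longrightarrow> open {t. a + cnj t *s b \<in> S}"
  using open_vimage[OF open_line_vimage[of S a b], of cnj]
  by (simp add: vimage_def continuous_intros)

text \<open>With \<open>a = (z + w)/2\<close> and \<open>b = (z - w)/(2\<i>)\<close>, the function \<open>t \<mapsto> K (a + t b) (a + cnj t b)\<close> is
  holomorphic, vanishes for real \<open>t\<close>, and has the value \<open>K z w\<close> at \<open>t = \<i>\<close>.\<close>
theorem sesquiholomorphic_eq_0_if_diagonal_eq_0:
  assumes K: "sesquiholomorphic_on K D D" and D: "open D" "convex D"
    and diag: "\<And>z. z \<in> D \<Longrightarrow> K z z = 0"
    and zw: "z \<in> D" "w \<in> D"
  shows "K z w = 0"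
proof -
  define a b where "a = (1/2) *s (z + w)" and "b = (1 / (2 * \<i>)) *s (z - w)"
  define T where "T = {t. a + t *s b \<in> D} \<inter> {t. a + cnj t *s b \<in> D}"
  have ends: "a + \<i> *s b = z" "a + cnj \<i> *s b = w"
    by (simp_all add: a_def b_def vec_eq_iff field_simps)
  have "a = (1/2) *\<^sub>R z + (1/2) *\<^sub>R w"
    by (simp add: a_def vec_eq_iff scaleR_conv_of_real[where 'a=complex] algebra_simps)
  then have "a \<in> D" using convexD[OF D(2) zw, of "1/2" "1/2"] by simp
  have "K (a + \<i> *s b) (a + cnj \<i> *s b) = 0"
  proof (rule holomorphic_eq_0_if_eq_0_on_reals[where S = T
      and f = "\<lambda>t. K (a + t *s b) (a + cnj t *s b)"])
    show "(\<lambda>t. K (a + t *s b) (a + cnj t *s b)) holomorphic_on T"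
      using K by (simp add: sesquiholomorphic_on_def T_def Collect_conj_eq)
    show "open T"
      unfolding T_def by (intro open_Int open_line_vimage open_cnj_line_vimage D)
    show "connected T"
      unfolding T_def
      by (intro convex_connected convex_Int convex_line_vimage convex_cnj_line_vimage D)
    show "0 \<in> T" using \<open>a \<in> D\<close> by (simp add: T_def)
    show "\<i> \<in> T" using ends zw by (simp add: T_def)
    show "K (a + of_real t *s b) (a + cnj (of_real t) *s b) = 0" if "of_real t \<in> T" for t
      using diag that by (simp add: T_def)
  qed
  then show ?thesis by (simp only: ends)
qed

lemma sesquiholomorphic_eq_0_if_local_diagonal_eq_0:
  assumes K: "sesquiholomorphic_on K D E" and D: "open D" and E: "open E" "convex E"
    and DE: "D \<subseteq> E" and diag: "\<And>z. z \<in> D \<Longrightarrow> K z z = 0"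
    and z: "z \<in> D" and w: "w \<in> E"
  shows "K z w = 0"
proof -
  obtain r where r: "r > 0" "ball z r \<subseteq> D" using D z openE by blast
  have K_ball: "K z x = 0" if "x \<in> ball z r" for x
  proof (rule sesquiholomorphic_eq_0_if_diagonal_eq_0[of K "ball z r"])
    show "sesquiholomorphic_on K (ball z r) (ball z r)"
      by (rule sesquiholomorphic_on_subset[OF K]) (use r(2) DE in auto)
  qed (use that r diag in auto)
  define T where "T = {t. z + cnj t *s (w - z) \<in> E}"
  define T' where "T' = {t. z + cnj t *s (w - z) \<in> ball z r}"
  have "K z (z + cnj 1 *s (w - z)) = 0"
  proof (rule analytic_continuation_open[where s = T' and s' = T and g = "\<lambda>_. 0"
        and f = "\<lambda>t. K z (z + cnj t *s (w - z))"])
    show "open T'" "open T" unfolding T_def T'_def by (intro open_cnj_line_vimage E open_ball)+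
    show "connected T" unfolding T_def by (intro convex_connected convex_cnj_line_vimage E)
    have "0 \<in> T'" using r by (simp add: T'_def)
    then show "T' \<noteq> {}" by blast
    show "T' \<subseteq> T" using r(2) DE by (auto simp: T_def T'_def)
    show "(\<lambda>t. K z (z + cnj t *s (w - z))) holomorphic_on T"
      using K[unfolded sesquiholomorphic_on_def, rule_format, of z 0 z "w - z"] z
      by (simp add: T_def)
  qed (use w K_ball in \<open>auto simp: T_def T'_def\<close>)
  then show ?thesis by simp
qed

section \<open>Wirtinger derivatives\<close>

lemma pdir_eq:
  assumes "(g has_derivative g') (at z)"
  shows "pdir g v z = g' v"
proof -
  interpret g': bounded_linear g' using assms by (rule has_derivative_bounded_linear)
  have "((\<lambda>t::real. z + t *\<^sub>R v) has_derivative (\<lambda>h. h *\<^sub>R v)) (at 0)"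
    by (auto intro!: derivative_eq_intros)
  from has_derivative_compose[OF this, of g g'] assms
  have "((\<lambda>t::real. g (z + t *\<^sub>R v)) has_derivative (\<lambda>h. g' (h *\<^sub>R v))) (at 0)" by simp
  then have "((\<lambda>t::real. g (z + t *\<^sub>R v)) has_vector_derivative g' v) (at 0)"
    by (simp add: has_vector_derivative_def g'.scaleR)
  then show ?thesis unfolding pdir_def by (rule vector_derivative_at)
qed

lemma has_derivative_wirtinger:
  fixes g :: "complex^'n::finite \<Rightarrow> complex"
  assumes "g differentiable (at z)"
  shows "(g has_derivative (\<lambda>v. (\<chi> j. wd j g z) \<cdot> v + \<langle>\<chi> j. wdbar j g z, v\<rangle>)) (at z)"
proof -
  obtain g' where g': "(g has_derivative g') (at z)" using assms by (auto simp: differentiable_def)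
  interpret g': bounded_linear g' using g' by (rule has_derivative_bounded_linear)
  have "g' v = (\<chi> j. wd j g z) \<cdot> v + \<langle>\<chi> j. wdbar j g z, v\<rangle>" for v
  proof -
    have "v = (\<Sum>j\<in>UNIV. Re (v $ j) *\<^sub>R axis j 1 + Im (v $ j) *\<^sub>R axis j \<i>)"
      by (simp add: vec_eq_iff axis_def if_distrib sum.distrib complex_eq_iff cong: if_cong)
    then have "g' v = g' (\<Sum>j\<in>UNIV. Re (v $ j) *\<^sub>R axis j 1 + Im (v $ j) *\<^sub>R axis j \<i>)"
      by (rule arg_cong)
    also have "\<dots> = (\<Sum>j\<in>UNIV. Re (v $ j) *\<^sub>R g' (axis j 1) + Im (v $ j) *\<^sub>R g' (axis j \<i>))"
      by (simp add: g'.sum g'.add g'.scaleR)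
    also have "\<dots> = (\<Sum>j\<in>UNIV. wd j g z * v $ j + wdbar j g z * cnj (v $ j))"
      by (intro sum.cong)
         (simp_all add: wd_def wdbar_def pdir_eq[OF g'] complex_eq_iff field_simps)
    finally show ?thesis by (simp add: cdot_def cinner_def sum.distrib)
  qed
  then show ?thesis using g' by presburger
qed

lemma differentiable_transform_open:
  assumes "f differentiable (at z)" "open S" "z \<in> S" "\<And>w. w \<in> S \<Longrightarrow> f w = g w"
  shows "g differentiable (at z)"
  using assms has_derivative_transform_within_open unfolding differentiable_def by metis

lemma wd_diff_cmult:
  assumes "f differentiable (at z)" "g differentiable (at z)"
  shows "wd j (\<lambda>w. f w - c * g w) z = wd j f z - c * wd j g z"
proof -
  obtain f' g' where f': "(f has_derivative f') (at z)" and g': "(g has_derivative g') (at z)"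
    using assms by (auto simp: differentiable_def)
  have "((\<lambda>w. f w - c * g w) has_derivative (\<lambda>v. f' v - c * g' v)) (at z)"
    by (intro derivative_intros f' g')
  then show ?thesis
    by (simp add: wd_def pdir_eq[OF f'] pdir_eq[OF g'] pdir_eq field_simps)
qed

lemma has_derivative_cnj_if_wd_eq_0:
  assumes "g differentiable (at z)" "\<And>j. wd j g z = 0"
  shows "((\<lambda>w. cnj (g w)) has_derivative (\<cdot>) (\<chi> j. cnj (wdbar j g z))) (at z)"
  using has_derivative_cnj[OF has_derivative_wirtinger[OF assms(1)]]
  by (rule has_derivative_eq_rhs) (simp add: fun_eq_iff assms(2) cdot_def cinner_def)

lemma wdbar_of_real:
  fixes f :: "complex^'n::finite \<Rightarrow> real"
  assumes "(f has_derivative (\<lambda>v. 2 * Re (d \<cdot> v))) (at z)"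
  shows "wdbar k (\<lambda>u. complex_of_real (f u)) z = cnj (d $ k)"
  unfolding wdbar_def
  by (subst (1 2) pdir_eq[OF has_derivative_of_real[OF assms]]) (simp add: complex_eq_iff)

lemma wdbar_ln_powr:
  fixes f :: "complex^'n::finite \<Rightarrow> real"
  assumes f: "(f has_derivative (\<lambda>v. 2 * Re (d \<cdot> v))) (at z)" and pos: "f z > 0" "c > 0"
  shows "wdbar k (\<lambda>u. complex_of_real (ln (c * f u powr e))) z
      = cnj (of_real e * d $ k / of_real (f z))"
proof -
  have "((\<lambda>u. ln (c * f u powr e)) has_derivative (\<lambda>v. e * (2 * Re (d \<cdot> v)) / f z)) (at z)"
    using pos by (auto intro!: derivative_eq_intros f simp: field_simps)
  also have "(\<lambda>v. e * (2 * Re (d \<cdot> v)) / f z) = (\<lambda>v. 2 * Re ((of_real (e / f z) *s d) \<cdot> v))"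
    by (simp add: fun_eq_iff del: of_real_divide)
  finally have "((\<lambda>u. ln (c * f u powr e)) has_derivative
      (\<lambda>v. 2 * Re ((of_real (e / f z) *s d) \<cdot> v))) (at z)" .
  from wdbar_of_real[OF this] show ?thesis by simp
qed

section \<open>Rational functions\<close>

lemma mpeval_has_derivative:
  "\<exists>p'. \<forall>z. (mpeval p has_derivative (\<cdot>) (\<chi> j. mpeval (p' j) z)) (at z)"
proof (induction p rule: mpoly_induct)
  case (const c)
  have "mpeval (mconst c) = (\<lambda>z. c)" by auto
  then show ?case by (intro exI[of _ "\<lambda>j. 0"]) (auto simp: cdot_def)
next
  case (var j)
  have "mpeval (mvar j) = (\<lambda>z. z $ j)" by auto
  moreover have "(\<chi> i. mpeval (mconst (of_bool (i = j))) z) \<cdot> v = v $ j" for z v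
    by (simp add: cdot_def of_bool_def if_distrib[of "\<lambda>x. x * _"] cong: if_cong)
  ultimately show ?case
    by (intro exI[of _ "\<lambda>i. mconst (of_bool (i = j))"])
       (auto intro!: bounded_linear_imp_has_derivative bounded_linear_vec_nth)
next
  case (add p q)
  then obtain p' q' where derivs:
    "\<And>z. (mpeval p has_derivative (\<cdot>) (\<chi> j. mpeval (p' j) z)) (at z)"
    "\<And>z. (mpeval q has_derivative (\<cdot>) (\<chi> j. mpeval (q' j) z)) (at z)" by blast
  have eval: "mpeval (p + q) = (\<lambda>z. mpeval p z + mpeval q z)" by auto
  show ?case unfolding eval
    by (intro exI[of _ "\<lambda>i. p' i + q' i"] allI
        has_derivative_eq_rhs[OF has_derivative_add[OF derivs]])
       (simp add: fun_eq_iff cdot_def algebra_simps sum.distrib)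
next
  case (mult p q)
  then obtain p' q' where derivs:
    "\<And>z. (mpeval p has_derivative (\<cdot>) (\<chi> j. mpeval (p' j) z)) (at z)"
    "\<And>z. (mpeval q has_derivative (\<cdot>) (\<chi> j. mpeval (q' j) z)) (at z)" by blast
  have eval: "mpeval (p * q) = (\<lambda>z. mpeval p z * mpeval q z)" by auto
  show ?case unfolding eval
    by (intro exI[of _ "\<lambda>i. p' i * q + p * q' i"] allI
        has_derivative_eq_rhs[OF has_derivative_mult[OF derivs]])
       (simp add: fun_eq_iff cdot_def algebra_simps sum.distrib sum_distrib_left)
qed

definition rational_on :: "(complex^'n::finite \<Rightarrow> complex) \<Rightarrow> (complex^'n) set \<Rightarrow> bool" where
  "rational_on f S \<longleftrightarrow> (\<exists>p r. \<forall>z\<in>S. mpeval r z \<noteq> 0 \<and> f z = mpeval p z / mpeval r z)"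

lemma rational_on_cong:
  assumes "rational_on f S" "\<And>z. z \<in> S \<Longrightarrow> f z = g z"
  shows "rational_on g S"
  using assms unfolding rational_on_def by metis

lemma rational_on_has_derivative:
  assumes "rational_on f S" "open S"
  obtains d where "\<And>j. rational_on (\<lambda>z. d z $ j) S"
    and "\<And>z. z \<in> S \<Longrightarrow> (f has_derivative (\<cdot>) (d z)) (at z)"
proof -
  obtain p r where r: "\<And>z. z \<in> S \<Longrightarrow> mpeval r z \<noteq> 0"
    and f: "\<And>z. z \<in> S \<Longrightarrow> f z = mpeval p z / mpeval r z"
    using assms(1) unfolding rational_on_def by blast
  obtain p' where p': "\<And>z. (mpeval p has_derivative (\<cdot>) (\<chi> j. mpeval (p' j) z)) (at z)"
    using mpeval_has_derivative by blast
  obtain r' where r': "\<And>z. (mpeval r has_derivative (\<cdot>) (\<chi> j. mpeval (r' j) z)) (at z)"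
    using mpeval_has_derivative by blast
  define d where "d z = (\<chi> j. mpeval (p' j * r - p * r' j) z / mpeval (r * r) z)" for z
  show ?thesis
  proof (rule that[of d])
    show "rational_on (\<lambda>z. d z $ j) S" for j
      unfolding rational_on_def d_def
      by (intro exI[of _ "p' j * r - p * r' j"] exI[of _ "r * r"]) (use r in auto)
    fix z assume z: "z \<in> S"
    have "((\<lambda>z. mpeval p z / mpeval r z) has_derivative (\<cdot>) (d z)) (at z)"
      by (rule has_derivative_eq_rhs[OF has_derivative_divide'[OF p' r' r[OF z]]])
         (use r[OF z] in \<open>simp add: fun_eq_iff d_def cdot_def sum_distrib_left sum_distrib_right
            algebra_simps flip: sum_subtractf sum_divide_distrib\<close>)
    then show "(f has_derivative (\<cdot>) (d z)) (at z)"
      by (rule has_derivative_transform_within_open[OF _ assms(2) z]) (simp add: f)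
  qed
qed

section \<open>One complex variable\<close>

lemma log_derivative_residue:
  fixes A B :: "'a::field poly"
  assumes A: "A \<noteq> 0" and B: "B \<noteq> 0"
    and eq: "(pderiv A * B - A * pderiv B) * [:-x, 1:] = smult c (A * B)"
  shows "c = of_nat (order x A) - of_nat (order x B)"
proof -
  define L where "L = [:-x, 1:]"
  have [simp]: "pderiv L = 1" "poly L x = 0" "L \<noteq> 0"
    by (simp_all add: L_def pderiv_pCons)
  define a b where "a = order x A" and "b = order x B"
  obtain A1 where A1: "A = L ^ a * A1" "\<not> L dvd A1"
    using order_decomp[OF A] unfolding a_def L_def by blast
  obtain B1 where B1: "B = L ^ b * B1" "\<not> L dvd B1"
    using order_decomp[OF B] unfolding b_def L_def by blast
  have L_pderiv: "L * pderiv (L ^ n * Q) = L ^ n * (smult (of_nat n) Q + L * pderiv Q)" for n Q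
  proof (cases n)
    case (Suc k)
    show ?thesis
      unfolding Suc pderiv_mult pderiv_power_Suc by (simp add: algebra_simps del: of_nat_Suc)
  qed simp
  have "L ^ (a + b) *
      (smult (of_nat a - of_nat b) (A1 * B1) + L * (pderiv A1 * B1 - A1 * pderiv B1))
    = (L * pderiv A) * B - A * (L * pderiv B)"
    unfolding A1(1) B1(1) L_pderiv by (simp add: power_add smult_diff_left algebra_simps)
  also have "\<dots> = smult c (A * B)"
    using eq by (simp add: L_def[symmetric] algebra_simps)
  also have "\<dots> = L ^ (a + b) * smult c (A1 * B1)"
    unfolding A1(1) B1(1) by (simp add: power_add algebra_simps)
  finally have "smult (of_nat a - of_nat b) (A1 * B1) + L * (pderiv A1 * B1 - A1 * pderiv B1)
    = smult c (A1 * B1)"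
    unfolding mult_cancel_left by simp
  from arg_cong[OF this, of "\<lambda>p. poly p x"]
  have "(of_nat a - of_nat b) * poly (A1 * B1) x = c * poly (A1 * B1) x" by simp
  moreover have "poly (A1 * B1) x \<noteq> 0"
    using A1(2) B1(2) by (simp add: poly_eq_0_iff_dvd L_def)
  ultimately show ?thesis by (simp add: a_def b_def)
qed

lemma rational_log_derivative_exponent:
  fixes A B :: "complex poly" and h h' :: "complex \<Rightarrow> complex"
  assumes S: "open S" "t0 \<in> S" "h t0 \<noteq> 0" and q: "q \<noteq> 0"
    and h: "\<And>t. t \<in> S \<Longrightarrow> poly B t \<noteq> 0 \<and> h t = poly A t / poly B t"
    and deriv: "\<And>t. t \<in> S \<Longrightarrow> (h has_field_derivative h' t) (at t)"
    and ode: "\<And>t. t \<in> S \<Longrightarrow> h' t * (1 - t * q) = - (c * q * h t)"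
  shows "\<exists>a b :: nat. c = of_nat a - of_nat b"
proof -
  have "(pderiv A * B - A * pderiv B) * [:- (1 / q), 1:] = smult c (A * B)"
  proof (rule poly_eqI_open[OF S(1)])
    show "S \<noteq> {}" using S(2) by blast
    fix t assume t: "t \<in> S"
    let ?d = "(poly (pderiv A) t * poly B t - poly A t * poly (pderiv B) t) / (poly B t * poly B t)"
    have "((\<lambda>t. poly A t / poly B t) has_field_derivative ?d) (at t)"
      using h[OF t] by (intro DERIV_divide poly_DERIV) auto
    then have "(h has_field_derivative ?d) (at t)"
      by (rule has_field_derivative_transform_within_open[OF _ S(1) t]) (simp add: h)
    then have "h' t = ?d" using deriv[OF t] DERIV_unique by blast
    then have "?d * (1 - t * q) = - (c * q * (poly A t / poly B t))"
      using ode[OF t] h[OF t] by simp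
    then show "poly ((pderiv A * B - A * pderiv B) * [:- (1 / q), 1:]) t = poly (smult c (A * B)) t"
      using h[OF t] q by (simp add: field_simps) algebra
  qed
  moreover have "A \<noteq> 0" "B \<noteq> 0" using h[OF S(2)] S(3) by auto
  ultimately show ?thesis using log_derivative_residue by blast
qed

lemma quotient_power_constant_if_log_derivative_eq:
  fixes h M :: "complex \<Rightarrow> complex"
  assumes S: "open S" "connected S" "finite E"
    and h: "\<And>t. t \<in> S \<Longrightarrow> (h has_field_derivative h' t) (at t)"
    and M: "\<And>t. t \<in> S \<Longrightarrow> (M has_field_derivative M' t) (at t)" "\<And>t. t \<in> S \<Longrightarrow> M t \<noteq> 0"
    and ode: "\<And>t. t \<in> S - E \<Longrightarrow> h' t * M t = of_nat k * M' t * h t"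
    and st: "s \<in> S" "t \<in> S"
  shows "h t / M t ^ k = h s / M s ^ k"
proof -
  have quotient: "((\<lambda>t. h t / M t ^ k) has_field_derivative
      (h' t - of_nat k * M' t * h t / M t) / M t ^ k) (at t)" if t: "t \<in> S" for t
  proof -
    have "((\<lambda>t. h t / M t ^ k) has_field_derivative
        (h' t * M t ^ k - h t * (of_nat k * (M' t * M t ^ (k - Suc 0)))) / (M t ^ k * M t ^ k))
        (at t)"
      using M(2)[OF t] by (intro DERIV_divide DERIV_power h M t) auto
    moreover have "of_nat k * M t ^ (k - Suc 0) = of_nat k * M t ^ k / M t"
      using M(2)[OF t] by (cases k) auto
    ultimately show ?thesis
      using M(2)[OF t] by (elim DERIV_cong) (auto simp: field_simps)
  qed
  obtain C where "\<And>t. t \<in> S \<Longrightarrow> h t / M t ^ k = C"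
  proof (rule DERIV_zero_connected_constant[OF S(2,1,3)])
    show "continuous_on S (\<lambda>t. h t / M t ^ k)"
      using quotient DERIV_isCont by (blast intro: continuous_at_imp_continuous_on)
    show "\<forall>t\<in>S - E. ((\<lambda>t. h t / M t ^ k) has_field_derivative 0) (at t)"
    proof
      fix t assume t: "t \<in> S - E"
      then have "h' t - of_nat k * M' t * h t / M t = 0"
        using ode[OF t] M(2)[of t] by (simp add: field_simps)
      then show "((\<lambda>t. h t / M t ^ k) has_field_derivative 0) (at t)"
        using quotient[of t] t by simp
    qed
  qed blast
  then show ?thesis using st by simp
qed

lemma square_multiple_no_simple_root:
  fixes X Y D :: "'a::field_char_0 poly"
  assumes eq: "X\<^sup>2 = D * Y\<^sup>2" and Y: "Y \<noteq> 0"
    and t: "poly D t = 0" "poly (pderiv D) t \<noteq> 0"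
  shows False
proof -
  have D: "D \<noteq> 0" using t(2) by auto
  have "order t D = Suc (order t (pderiv D))"
    using t D by (intro order_pderiv) (auto simp: order_root)
  then have "order t D = 1" using t(2) by (simp add: order_0I)
  then have "order t (D * Y\<^sup>2) = 1 + 2 * order t Y"
    using D Y by (simp add: order_mult power2_eq_square)
  moreover have "X \<noteq> 0" using eq D Y by auto
  then have "order t (X\<^sup>2) = 2 * order t X" by (simp add: order_mult power2_eq_square)
  ultimately show False unfolding eq by presburger
qed

text \<open>The roots of \<open>(1 - l t)\<^sup>2 - w\<^sup>2 t\<^sup>2\<close> are \<open>1/(l + w)\<close> and \<open>1/(l - w)\<close>.\<close>
lemma discriminant_simple_root:
  fixes d l :: complex
  assumes "d \<noteq> 0"
  obtains t where "poly [:1, - 2 * l, l\<^sup>2 - d:] t = 0" "poly (pderiv [:1, - 2 * l, l\<^sup>2 - d:]) t \<noteq> 0"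
proof -
  obtain w where w: "w\<^sup>2 = d" "l + w \<noteq> 0"
  proof (cases "l + csqrt d = 0")
    case True
    then have "l + - csqrt d = - 2 * csqrt d" by (simp add: add_eq_0_iff2)
    then show ?thesis using assms by (intro that[of "- csqrt d"]) auto
  next
    case False
    then show ?thesis by (intro that[of "csqrt d"]) auto
  qed
  have w_nonzero: "w \<noteq> 0" using w(1) assms by auto
  define t where "t = 1 / (l + w)"
  have t: "(l + w) * t = 1" using w(2) by (simp add: t_def)
  have "poly [:1, - 2 * l, l\<^sup>2 - d:] t = (1 - (l + w) * t) * (1 - (l - w) * t)"
    by (simp add: w(1)[symmetric] power2_eq_square algebra_simps)
  moreover have "poly (pderiv [:1, - 2 * l, l\<^sup>2 - d:]) t = 2 * ((l - w) * ((l + w) * t) - l)"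
    by (simp add: pderiv_pCons w(1)[symmetric] power2_eq_square algebra_simps)
  ultimately show ?thesis using w_nonzero by (intro that[of t]) (simp_all add: t)
qed

subsection \<open>Taylor coefficients\<close>

lemma fps_nth_one_plus_linear_power:
  fixes c :: "'a::comm_ring_1"
  shows "fps_nth ((1 + fps_const c * fps_X) ^ k) n = of_nat (k choose n) * c ^ n"
proof (induction k arbitrary: n)
  case 0 then show ?case by (cases n) auto
next
  case (Suc k)
  have "fps_nth ((1 + fps_const c * fps_X) ^ Suc k) n
    = fps_nth ((1 + fps_const c * fps_X) ^ k) n
      + c * fps_nth (fps_X * (1 + fps_const c * fps_X) ^ k) n"
    by (simp add: distrib_right mult.assoc)
  also have "\<dots> = of_nat (k choose n) * c ^ n
      + c * (if n = 0 then 0 else of_nat (k choose (n - 1)) * c ^ (n - 1))"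
    by (simp only: fps_X_mult_nth Suc.IH)
  finally show ?case by (cases n) (simp_all add: algebra_simps)
qed

lemma has_fps_expansion_unique_on:
  fixes f g :: "complex \<Rightarrow> complex"
  assumes "f has_fps_expansion A" "g has_fps_expansion B" "open S" "0 \<in> S"
    and "\<And>t. t \<in> S \<Longrightarrow> f t = g t"
  shows "A = B"
proof -
  have "eventually (\<lambda>t. f t = g t) (nhds 0)"
    using assms(3-5) eventually_nhds by blast
  then have "g has_fps_expansion A"
    using assms(1) has_fps_expansion_cong by blast
  then show ?thesis
    using assms(2) by (simp add: fps_eq_iff fps_nth_fps_expansion)
qed

lemma taylor_coefficient_cinner_power:
  fixes f :: "complex \<Rightarrow> complex^'m::finite"
  assumes S: "open S" "0 \<in> S" and \<Phi>: "\<And>i. (\<lambda>t. f t $ i) has_fps_expansion \<Phi> i"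
    and \<Phi>_0: "\<And>i. fps_nth (\<Phi> i) 0 = 0" and isotropic: "(\<Sum>i\<in>UNIV. (fps_nth (\<Phi> i) 1)\<^sup>2) = 0"
    and eq: "\<And>t. t \<in> S \<Longrightarrow> \<langle>f t, v\<rangle> - (f t \<cdot> f t) * \<beta> = 1 - (1 - t * c) ^ k"
  shows "\<langle>\<chi> i. fps_nth (\<Phi> i) 2, v\<rangle> = - (of_nat (k choose 2) * c\<^sup>2)"
proof -
  let ?\<Psi> = "(\<Sum>i\<in>UNIV. \<Phi> i * fps_const (cnj (v $ i))) - (\<Sum>i\<in>UNIV. \<Phi> i * \<Phi> i) * fps_const \<beta>"
  have "(\<lambda>t. (\<Sum>i\<in>UNIV. f t $ i * cnj (v $ i)) - (\<Sum>i\<in>UNIV. f t $ i * f t $ i) * \<beta>)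
      has_fps_expansion ?\<Psi>"
    by (intro fps_expansion_intros \<Phi>)
  moreover have "(\<lambda>t. 1 - (1 + (- c) * t) ^ k)
      has_fps_expansion 1 - (1 + fps_const (- c) * fps_X) ^ k"
    by (intro fps_expansion_intros)
  ultimately have "?\<Psi> = 1 - (1 + fps_const (- c) * fps_X) ^ k"
    by (rule has_fps_expansion_unique_on[OF _ _ S])
       (use eq in \<open>simp add: cinner_def cdot_def mult.commute[of c]\<close>)
  then have "fps_nth ?\<Psi> 2 = - (of_nat (k choose 2) * c\<^sup>2)"
    by (simp add: fps_nth_one_plus_linear_power[where c = "- c"])
  moreover have "fps_nth (\<Phi> i * \<Phi> i) 2 = (fps_nth (\<Phi> i) 1)\<^sup>2" for i
    by (simp add: fps_mult_nth \<Phi>_0 numeral_2_eq_2 power2_eq_square)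
  ultimately show ?thesis
    using isotropic by (simp add: fps_sum_nth cinner_def)
qed

lemma taylor_coefficient_cinner_monom:
  fixes f :: "complex \<Rightarrow> complex^'m::finite"
  assumes S: "open S" "0 \<in> S" and \<Phi>: "\<And>i. (\<lambda>t. f t $ i) has_fps_expansion \<Phi> i"
    and eq: "\<And>t. t \<in> S \<Longrightarrow> \<langle>f t, v\<rangle> = C * t ^ n"
  shows "\<langle>\<chi> i. fps_nth (\<Phi> i) n, v\<rangle> = C"
proof -
  have "(\<lambda>t. \<Sum>i\<in>UNIV. f t $ i * cnj (v $ i))
      has_fps_expansion (\<Sum>i\<in>UNIV. \<Phi> i * fps_const (cnj (v $ i)))"
    by (intro fps_expansion_intros \<Phi>)
  moreover have "(\<lambda>t. C * t ^ n) has_fps_expansion fps_const C * fps_X ^ n"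
    by (intro fps_expansion_intros)
  ultimately have "(\<Sum>i\<in>UNIV. \<Phi> i * fps_const (cnj (v $ i))) = fps_const C * fps_X ^ n"
    by (rule has_fps_expansion_unique_on[OF _ _ S]) (use eq in \<open>simp add: cinner_def\<close>)
  from arg_cong[OF this, of "\<lambda>\<Psi>. fps_nth \<Psi> n"] show ?thesis
    by (simp add: fps_sum_nth cinner_def)
qed

text \<open>The coefficient of \<open>t\<^sup>2 (cnj s)\<^sup>2\<close> is a squared norm on the left, as \<open>f \<cdot> f\<close> has no \<open>t\<^sup>2\<close> term;
  on the right it is \<open>- q\<^sup>2 k (k - 1) / 2\<close>.\<close>
lemma gram_power_exponent_le_1:
  fixes f :: "complex \<Rightarrow> complex^'m::finite" and q :: real
  assumes S: "open S" "0 \<in> S" and hol: "\<And>i. (\<lambda>t. f t $ i) holomorphic_on S"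
    and f_0: "f 0 = 0" and isotropic: "(\<Sum>i\<in>UNIV. (deriv (\<lambda>t. f t $ i) 0)\<^sup>2) = 0" and q: "q \<noteq> 0"
    and eq: "\<And>t s. t \<in> S \<Longrightarrow> s \<in> S \<Longrightarrow>
      \<langle>f t, f s\<rangle> - (f t \<cdot> f t) * (cnj (f s \<cdot> f s) / 4) = 1 - (1 - t * (cnj s * of_real q)) ^ k"
  shows "k \<le> 1"
proof (rule ccontr)
  assume k: "\<not> k \<le> 1"
  define \<Phi> where "\<Phi> i = fps_expansion (\<lambda>t. f t $ i) 0" for i
  have \<Phi>: "(\<lambda>t. f t $ i) has_fps_expansion \<Phi> i" for i
    unfolding \<Phi>_def using S hol by blast
  define a where "a = (\<chi> i. fps_nth (\<Phi> i) 2)"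
  define C where "C = real (k choose 2) * q\<^sup>2"
  have "\<langle>f s, a\<rangle> = - of_real C * s ^ 2" if s: "s \<in> S" for s
  proof -
    have "\<langle>a, f s\<rangle> = - (of_nat (k choose 2) * (cnj s * of_real q)\<^sup>2)"
      unfolding a_def
      by (rule taylor_coefficient_cinner_power[OF S \<Phi> _ _ eq[OF _ s]])
         (use f_0 isotropic in \<open>simp_all add: fps_nth_fps_expansion[OF \<Phi>]\<close>)
    from arg_cong[OF this, of cnj] show ?thesis
      by (simp add: C_def power_mult_distrib mult_ac)
  qed
  then have "\<langle>a, a\<rangle> = - of_real C"
    unfolding a_def by (rule taylor_coefficient_cinner_monom[OF S \<Phi>])
  then have "complex_of_real ((norm a)\<^sup>2) = complex_of_real (- C)"
    by (simp add: cinner_self)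
  then have "(norm a)\<^sup>2 = - C" by (simp only: of_real_eq_iff)
  moreover have "C > 0"
    using k q by (simp add: C_def zero_less_binomial_iff)
  ultimately show False by (smt (verit) zero_le_power2)
qed

section \<open>Generic norms\<close>

definition generic_norm_ball :: "complex^'n::finite \<Rightarrow> complex^'n \<Rightarrow> complex" where
  "generic_norm_ball z w = 1 - \<langle>z, w\<rangle>"

definition generic_norm_IV :: "complex^'m::finite \<Rightarrow> complex^'m \<Rightarrow> complex" where
  "generic_norm_IV Z W = 1 - \<langle>Z, W\<rangle> + (Z \<cdot> Z) * cnj (W \<cdot> W) / 4"

definition generic_norm_IV_deriv :: "complex^'m::finite \<Rightarrow> complex^'m \<Rightarrow> complex^'m \<Rightarrow> complex" where
  "generic_norm_IV_deriv Z W V = - \<langle>V, W\<rangle> + (Z \<cdot> V) * cnj (W \<cdot> W) / 2"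

lemma Re_cinner_self: "Re \<langle>v, v\<rangle> = (\<Sum>j\<in>UNIV. (cmod (v $ j))\<^sup>2)"
  by (simp add: cinner_def cmod_power2 flip: power2_eq_square)

lemma unit_ball_eq_ball: "unit_ball = ball (0 :: complex^'n::finite) 1"
proof -
  have "norm z < 1 \<longleftrightarrow> (norm z)\<^sup>2 < 1" for z :: "complex^'n"
    using abs_square_less_1[of "norm z"] by simp
  moreover have "(\<Sum>j\<in>UNIV. (cmod (z $ j))\<^sup>2) = (norm z)\<^sup>2" for z :: "complex^'n"
    by (simp flip: Re_cinner_self add: cinner_self)
  ultimately show ?thesis by (auto simp: unit_ball_def)
qed

lemma zero_in_unit_ball [simp]: "0 \<in> unit_ball"
  and open_unit_ball: "open unit_ball" and convex_unit_ball: "convex unit_ball"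
  by (simp_all add: unit_ball_eq_ball)

lemma K_ball_eq: "K_ball c z = c * Re (generic_norm_ball z z) powr - real (CARD('n) + 1)"
  for z :: "complex^'n::finite"
  by (simp add: K_ball_def generic_norm_ball_def Re_cinner_self)

lemma Re_generic_norm_IV_self: "Re (generic_norm_IV Z Z)
    = 1 - (\<Sum>j\<in>UNIV. (cmod (Z $ j))\<^sup>2) + (cmod (\<Sum>j\<in>UNIV. (Z $ j)\<^sup>2))\<^sup>2 / 4"
proof -
  have "Re ((Z \<cdot> Z) * cnj (Z \<cdot> Z)) = (cmod (Z \<cdot> Z))\<^sup>2"
    by (simp only: complex_norm_square[symmetric] Re_complex_of_real)
  then show ?thesis
    by (simp add: generic_norm_IV_def Re_cinner_self flip: cdot_self)
qed

lemma K_IV_eq: "K_IV c Z = c * Re (generic_norm_IV Z Z) powr - real CARD('m)"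
  for Z :: "complex^'m::finite"
  by (simp add: K_IV_def Re_generic_norm_IV_self)

lemma of_real_Re_generic_norm_ball:
  "complex_of_real (Re (generic_norm_ball z z)) = generic_norm_ball z z"
  by (simp add: generic_norm_ball_def cinner_self)

lemma of_real_Re_generic_norm_IV:
  "complex_of_real (Re (generic_norm_IV Z Z)) = generic_norm_IV Z Z"
  by (simp add: generic_norm_IV_def cinner_self complex_eq_iff)

lemma Re_generic_norm_IV_pos: "Z \<in> typeIV_domain \<Longrightarrow> Re (generic_norm_IV Z Z) > 0"
  by (simp add: typeIV_domain_def Re_generic_norm_IV_self)

lemma generic_norm_ball_nonzero:
  assumes "z \<in> unit_ball" "w \<in> unit_ball"
  shows "generic_norm_ball z w \<noteq> 0"
proof -
  have "norm z * norm w < 1 * 1"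
    using assms by (intro mult_strict_mono') (auto simp: unit_ball_eq_ball)
  then have "cmod \<langle>z, w\<rangle> < 1" using norm_cinner_le[of z w] by linarith
  then show ?thesis by (auto simp: generic_norm_ball_def)
qed

lemma Re_generic_norm_ball_pos: "z \<in> unit_ball \<Longrightarrow> Re (generic_norm_ball z z) > 0"
  by (simp add: generic_norm_ball_def Re_cinner_self unit_ball_def)

lemma sesquiholomorphic_generic_norm_ball:
  "open E \<Longrightarrow> sesquiholomorphic_on generic_norm_ball D E"
  unfolding generic_norm_ball_def[abs_def] cinner_def
  by (intro sesquiholomorphic_intros sesquiholomorphic_on_left sesquiholomorphic_on_cnj_right
      gateaux_holomorphic_on_nth)

lemma Re_generic_norm_ball_has_derivative:
  "((\<lambda>z. Re (generic_norm_ball z z)) has_derivative (\<lambda>v. 2 * Re (- (\<chi> j. cnj (z $ j)) \<cdot> v))) (at z)"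
proof -
  have "((\<lambda>z. generic_norm_ball z z) has_derivative (\<lambda>v. - (\<langle>z, v\<rangle> + \<langle>v, z\<rangle>))) (at z)"
    unfolding generic_norm_ball_def by (auto intro!: derivative_eq_intros)
  from has_derivative_Re[OF this] show ?thesis
  proof (rule has_derivative_eq_rhs, intro ext)
    fix v
    have "Re \<langle>z, v\<rangle> = Re \<langle>v, z\<rangle>" by (metis cnj_cinner cnj.simps(1))
    moreover have "(\<chi> j. cnj (z $ j)) \<cdot> v = \<langle>v, z\<rangle>"
      by (simp add: cinner_conv_cdot cdot_commute)
    ultimately show "Re (- (\<langle>z, v\<rangle> + \<langle>v, z\<rangle>)) = 2 * Re (- (\<chi> j. cnj (z $ j)) \<cdot> v)"
      by (simp add: cdot.minus_left)
  qed
qed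

lemma generic_norm_IV_has_derivative:
  assumes "(F has_derivative F') (at z)"
  shows "((\<lambda>z. generic_norm_IV (F z) W) has_derivative
    (\<lambda>v. generic_norm_IV_deriv (F z) W (F' v))) (at z)"
  unfolding generic_norm_IV_def generic_norm_IV_deriv_def
  by (auto intro!: derivative_eq_intros assms simp: fun_eq_iff cdot_commute algebra_simps)

lemma Re_generic_norm_IV_has_derivative:
  assumes "(F has_derivative F') (at z)"
  shows "((\<lambda>z. Re (generic_norm_IV (F z) (F z))) has_derivative
    (\<lambda>v. 2 * Re (generic_norm_IV_deriv (F z) (F z) (F' v)))) (at z)"
proof -
  have "((\<lambda>z. generic_norm_IV (F z) (F z)) has_derivative
     (\<lambda>v. generic_norm_IV_deriv (F z) (F z) (F' v)
         + cnj (generic_norm_IV_deriv (F z) (F z) (F' v)))) (at z)"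
    unfolding generic_norm_IV_def generic_norm_IV_deriv_def
    by (auto intro!: derivative_eq_intros assms simp: fun_eq_iff cdot_commute algebra_simps)
  from has_derivative_Re[OF this] show ?thesis by simp
qed

lemma generic_norm_IV_deriv_matrix:
  "generic_norm_IV_deriv Z W (J *v v) = (\<chi> k. generic_norm_IV_deriv Z W (column k J)) \<cdot> v"
  unfolding matrix_mult_sum
  by (simp add: generic_norm_IV_deriv_def cinner.sum_left cdot.sum_right cdot_def[of _ v]
      sum_distrib_left sum_distrib_right sum_divide_distrib sum.distrib sum_negf sum_subtractf
      algebra_simps)

section \<open>The functional equation of a rational isometry\<close>

locale rational_isometry =
  fixes F :: "complex^'n::finite \<Rightarrow> complex^'m::finite"
    and P :: "('n mpoly)^'m" and R :: "'n mpoly" and c c' lam :: real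
  assumes c_pos: "c > 0" and c'_pos: "c' > 0" and lam_pos: "lam > 0"
    and isometry: "holo_isometry c c' F lam"
    and rational: "rational_rep F P R"
    and F_0: "F 0 = 0"
begin

definition regular_set :: "(complex^'n) set" where "regular_set = {z \<in> unit_ball. mpeval R z \<noteq> 0}"

definition F' :: "complex^'n \<Rightarrow> complex^'n^'m" where
  "F' z = matrix (frechet_derivative F (at z))"

definition N :: "complex^'n \<Rightarrow> complex^'n \<Rightarrow> complex" where
  "N z w = generic_norm_IV (F z) (F w)"

definition gradN :: "complex^'n \<Rightarrow> complex^'n \<Rightarrow> complex^'n" where
  "gradN z w = (\<chi> k. generic_norm_IV_deriv (F z) (F w) (column k (F' z)))"

definition mu :: real where "mu = lam * real (CARD('n) + 1) / real CARD('m)"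

lemma mu_pos: "mu > 0"
  using lam_pos by (simp add: mu_def)

lemma R_nonzero: "R \<noteq> 0"
  using rational by (auto simp: rational_rep_def lowest_terms_rep_def)

lemma regular_set_subset: "regular_set \<subseteq> unit_ball"
  by (auto simp: regular_set_def)

lemma open_regular_set: "open regular_set"
proof -
  have "open (mpeval R -` (- {0}))" by (intro open_vimage continuous_on_mpeval) auto
  moreover have "regular_set = unit_ball \<inter> mpeval R -` (- {0})" by (auto simp: regular_set_def)
  ultimately show ?thesis using open_unit_ball by auto
qed

lemma regular_set_meets_open:
  assumes "open S" "z \<in> S" "z \<in> unit_ball"
  shows "S \<inter> regular_set \<noteq> {}"
  using mpoly_nonzero_in_open[OF R_nonzero, of "S \<inter> unit_ball"] assms open_unit_ball
  by (auto simp: regular_set_def)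

lemma regular_set_nonempty: "regular_set \<noteq> {}"
  using regular_set_meets_open[of UNIV 0] by simp

lemma eq_on_unit_ball_if_eq_on_regular_set:
  fixes f g :: "complex^'n \<Rightarrow> complex"
  assumes "continuous_on unit_ball f" "continuous_on unit_ball g"
    and eq: "\<And>z. z \<in> regular_set \<Longrightarrow> f z = g z" and z: "z \<in> unit_ball"
  shows "f z = g z"
proof (rule ccontr)
  assume neq: "f z \<noteq> g z"
  let ?S = "unit_ball \<inter> (\<lambda>w. f w - g w) -` (- {0})"
  have "open ?S"
    by (intro continuous_open_preimage continuous_on_diff assms open_unit_ball) auto
  then have "?S \<inter> regular_set \<noteq> {}" using neq z by (intro regular_set_meets_open) auto
  then show False using eq by auto
qed

lemma F_rational: "z \<in> regular_set \<Longrightarrow> F z $ i = mpeval (P $ i) z / mpeval R z"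
  using rational by (auto simp: rational_rep_def regular_set_def)

lemma F_has_derivative:
  assumes "z \<in> unit_ball"
  shows "(F has_derivative (*v) (F' z)) (at z)"
proof -
  obtain L where L: "(F has_derivative L) (at z)" "\<And>c v. L (c *s v) = c *s L v"
    using isometry assms unfolding holo_isometry_def holo_on_def by blast
  have "bounded_linear L" using L(1) by (rule has_derivative_bounded_linear)
  then have "Vector_Spaces.linear (*s) (*s) L"
    by (intro Vector_Spaces.linear_iff[THEN iffD2])
       (auto simp: L(2) linear_simps intro: vec.vector_space_axioms)
  then have "L = (*v) (F' z)"
    using frechet_derivative_at[OF L(1)] by (simp add: F'_def fun_eq_iff matrix_works)
  then show ?thesis using L(1) by simp
qed

lemma F_nth_has_derivative:
  assumes "z \<in> unit_ball"
  shows "((\<lambda>z. F z $ i) has_derivative (\<cdot>) (F' z $ i)) (at z)"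
  using bounded_linear.has_derivative[OF bounded_linear_vec_nth F_has_derivative[OF assms], of i]
  by (rule has_derivative_eq_rhs) (simp add: fun_eq_iff matrix_vector_mult_nth)

lemma continuous_F: "continuous_on unit_ball F"
  by (intro continuous_at_imp_continuous_on ballI has_derivative_continuous[OF F_has_derivative])

lemma gateaux_holomorphic_F: "gateaux_holomorphic_on (\<lambda>z. F z $ i) unit_ball"
  using F_nth_has_derivative by (blast intro: gateaux_holomorphic_onI)

lemma F'_has_derivative:
  assumes z: "z \<in> regular_set"
  shows "\<exists>d. ((\<lambda>z. F' z $ i $ k) has_derivative (\<cdot>) d) (at z)"
proof -
  have "rational_on (\<lambda>z. F z $ i) regular_set"
    unfolding rational_on_def using F_rational by (auto simp: regular_set_def)
  then obtain d where d: "\<And>j. rational_on (\<lambda>z. d z $ j) regular_set"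
    "\<And>z. z \<in> regular_set \<Longrightarrow> ((\<lambda>z. F z $ i) has_derivative (\<cdot>) (d z)) (at z)"
    using rational_on_has_derivative open_regular_set by blast
  have "d w $ k = F' w $ i $ k" if "w \<in> regular_set" for w
  proof -
    have "(\<cdot>) (d w) = (\<cdot>) (F' w $ i)"
      using d(2) F_nth_has_derivative regular_set_subset that
      by (blast intro: has_derivative_unique)
    from fun_cong[OF this, of "axis k 1"] show ?thesis by simp
  qed
  then have "rational_on (\<lambda>z. F' z $ i $ k) regular_set"
    using d(1) by (rule rational_on_cong[rotated])
  then show ?thesis using rational_on_has_derivative open_regular_set z by metis
qed

lemma gateaux_holomorphic_F': "gateaux_holomorphic_on (\<lambda>z. F' z $ i $ k) regular_set"
  using F'_has_derivative by (rule gateaux_holomorphic_onI)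

lemma N_has_derivative:
  assumes "z \<in> unit_ball"
  shows "((\<lambda>z. N z w) has_derivative (\<cdot>) (gradN z w)) (at z)"
  using generic_norm_IV_has_derivative[OF F_has_derivative[OF assms], of "F w"]
  by (simp add: N_def[abs_def] gradN_def generic_norm_IV_deriv_matrix)

lemma Re_N_has_derivative:
  assumes "z \<in> unit_ball"
  shows "((\<lambda>z. Re (N z z)) has_derivative (\<lambda>v. 2 * Re (gradN z z \<cdot> v))) (at z)"
  using Re_generic_norm_IV_has_derivative[OF F_has_derivative[OF assms]]
  by (simp add: N_def gradN_def generic_norm_IV_deriv_matrix)

lemma Re_N_pos: "z \<in> unit_ball \<Longrightarrow> Re (N z z) > 0"
  using isometry by (auto simp: holo_isometry_def N_def intro: Re_generic_norm_IV_pos)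

lemma of_real_Re_N: "complex_of_real (Re (N z z)) = N z z"
  unfolding N_def by (rule of_real_Re_generic_norm_IV)

lemma N_0_right [simp]: "N z 0 = 1"
  and gradN_0_right [simp]: "gradN z 0 = 0"
  by (simp_all add: N_def gradN_def generic_norm_IV_def generic_norm_IV_deriv_def F_0
      vec_eq_iff)

lemma wdbar_ln_K_IV:
  assumes "z \<in> unit_ball"
  shows "wdbar k (\<lambda>u. complex_of_real (ln (K_IV c' (F u)))) z
    = cnj (- of_nat CARD('m) * gradN z z $ k / N z z)"
  using wdbar_ln_powr[OF Re_N_has_derivative[OF assms] Re_N_pos[OF assms] c'_pos,
      of k "- real CARD('m)"]
  by (simp add: K_IV_eq N_def of_real_Re_generic_norm_IV)

lemma wdbar_ln_K_ball:
  fixes z :: "complex^'n"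
  assumes "z \<in> unit_ball"
  shows "wdbar k (\<lambda>u. complex_of_real (ln (K_ball c u))) z
    = cnj (of_nat (CARD('n) + 1) * cnj (z $ k) / generic_norm_ball z z)"
  using wdbar_ln_powr[OF Re_generic_norm_ball_has_derivative
      Re_generic_norm_ball_pos[OF assms] c_pos, of k "- real (CARD('n) + 1)"]
  by (simp add: K_ball_eq of_real_Re_generic_norm_ball algebra_simps)

text \<open>The isometry condition says exactly that this Wirtinger derivative of \<open>ln N - mu ln M\<close>,
  where \<open>M z = 1 - |z|\<^sup>2\<close>, is holomorphic.\<close>
definition grad_log_ratio :: "complex^'n \<Rightarrow> complex^'n" where
  "grad_log_ratio z = (1 / N z z) *s gradN z z
      + (of_real mu / generic_norm_ball z z) *s (\<chi> k. cnj (z $ k))"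

lemma differentiable_N:
  assumes "z \<in> unit_ball"
  shows "(\<lambda>w. N w w) differentiable (at z)"
proof -
  have "(\<lambda>w. complex_of_real (Re (N w w))) differentiable (at z)"
    using has_derivative_of_real[OF Re_N_has_derivative[OF assms]]
    unfolding differentiable_def by blast
  then show ?thesis by (simp add: of_real_Re_N)
qed

lemma differentiable_gradN:
  assumes "z \<in> regular_set"
  shows "(\<lambda>w. gradN w w $ k) differentiable (at z)"
proof -
  have F: "(\<lambda>w. F w $ i) differentiable (at z)" for i
    using F_nth_has_derivative regular_set_subset assms unfolding differentiable_def by blast
  have F': "(\<lambda>w. F' w $ i $ k) differentiable (at z)" for i
    using F'_has_derivative[OF assms] unfolding differentiable_def by blast
  have products: "(\<lambda>w. F' w $ i $ k * cnj (F w $ i)) differentiable (at z)"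
    "(\<lambda>w. F w $ i * F' w $ i $ k) differentiable (at z)"
    "(\<lambda>w. F w $ i * F w $ i) differentiable (at z)" for i
    by (intro differentiable_mult differentiable_cnj_iff[THEN iffD2] F F')+
  show ?thesis
    unfolding gradN_def generic_norm_IV_deriv_def cinner_def cdot_def column_def vec_lambda_beta
    by (intro differentiable_add differentiable_minus differentiable_divide differentiable_mult
        differentiable_sum differentiable_const differentiable_cnj_iff[THEN iffD2] ballI products)
      simp_all
qed

lemma differentiable_wdbar_ln_K_IV:
  assumes "z \<in> regular_set"
  shows "(\<lambda>w. wdbar k (\<lambda>u. complex_of_real (ln (K_IV c' (F u)))) w) differentiable (at z)"
proof (rule differentiable_transform_open[OF _ open_regular_set assms])
  have z: "z \<in> unit_ball" using assms regular_set_subset by blast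
  then have "N z z \<noteq> 0" using Re_N_pos by force
  then show "(\<lambda>w. cnj (- of_nat CARD('m) * gradN w w $ k / N w w)) differentiable (at z)"
    unfolding differentiable_cnj_iff
    by (intro differentiable_divide differentiable_mult differentiable_const
        differentiable_N[OF z] differentiable_gradN[OF assms])
qed (use regular_set_subset in \<open>blast intro: wdbar_ln_K_IV[symmetric]\<close>)

lemma differentiable_wdbar_ln_K_ball:
  fixes z :: "complex^'n"
  assumes "z \<in> unit_ball"
  shows "(\<lambda>w. wdbar k (\<lambda>u. complex_of_real (ln (K_ball c u))) w) differentiable (at z)"
proof (rule differentiable_transform_open[OF _ open_unit_ball assms])
  have nth: "(\<lambda>w. w $ k) differentiable (at z)"
    using bounded_linear_imp_has_derivative[OF bounded_linear_vec_nth]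
    unfolding differentiable_def by blast
  have "(\<lambda>w. complex_of_real (Re (generic_norm_ball w w))) differentiable (at z)"
    using has_derivative_of_real[OF Re_generic_norm_ball_has_derivative]
    unfolding differentiable_def by blast
  then have norm: "(\<lambda>w. generic_norm_ball w w) differentiable (at z)"
    by (simp add: of_real_Re_generic_norm_ball)
  show "(\<lambda>w. cnj (of_nat (CARD('n) + 1) * cnj (w $ k) / generic_norm_ball w w))
      differentiable (at z)"
    unfolding differentiable_cnj_iff
    by (intro differentiable_divide differentiable_mult differentiable_const norm
        differentiable_cnj_iff[THEN iffD2] nth generic_norm_ball_nonzero assms)
qed (rule wdbar_ln_K_ball[symmetric])

lemma grad_log_ratio_has_derivative:
  assumes z: "z \<in> regular_set"
  shows "\<exists>d. ((\<lambda>z. grad_log_ratio z $ k) has_derivative (\<cdot>) d) (at z)"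
proof -
  let ?m = "of_nat CARD('m) :: complex"
  define dbar_IV where "dbar_IV = (\<lambda>w. wdbar k (\<lambda>u. complex_of_real (ln (K_IV c' (F u)))) w)"
  define dbar_ball where
    "dbar_ball = (\<lambda>w::complex^'n. wdbar k (\<lambda>u. complex_of_real (ln (K_ball c u))) w)"
  have z_ball: "z \<in> unit_ball" using z regular_set_subset by blast
  have diff: "dbar_IV differentiable (at z)" "dbar_ball differentiable (at z)"
    unfolding dbar_IV_def dbar_ball_def
    by (rule differentiable_wdbar_ln_K_IV[OF z] differentiable_wdbar_ln_K_ball[OF z_ball])+
  have "wd j dbar_IV z = lam * wd j dbar_ball z" for j
    using isometry z_ball unfolding holo_isometry_def levi_def dbar_IV_def dbar_ball_def by blast
  then have "wd j (\<lambda>w. dbar_IV w - lam * dbar_ball w) z = 0" for j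
    by (simp add: wd_diff_cmult[OF diff])
  moreover have "(\<lambda>w. dbar_IV w - lam * dbar_ball w) differentiable (at z)"
    by (intro differentiable_diff differentiable_mult differentiable_const diff)
  ultimately obtain d where d: "((\<lambda>w. cnj (dbar_IV w - lam * dbar_ball w))
      has_derivative (\<cdot>) d) (at z)"
    using has_derivative_cnj_if_wd_eq_0 by blast
  have holomorphic: "((\<lambda>w. (- 1 / ?m) * cnj (dbar_IV w - lam * dbar_ball w))
      has_derivative (\<cdot>) ((- 1 / ?m) *s d)) (at z)"
    by (rule has_derivative_eq_rhs[OF has_derivative_mult_right[OF d]])
       (rule ext, simp only: cdot_scale)
  have grad: "(- 1 / ?m) * cnj (dbar_IV w - lam * dbar_ball w) = grad_log_ratio w $ k"
    if "w \<in> regular_set" for w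
  proof -
    have w: "w \<in> unit_ball" using that regular_set_subset by blast
    then have eq: "cnj (dbar_IV w - lam * dbar_ball w) = - ?m * gradN w w $ k / N w w
        - lam * (of_nat (CARD('n) + 1) * cnj (w $ k) / generic_norm_ball w w)"
      by (simp only: dbar_IV_def dbar_ball_def wdbar_ln_K_IV wdbar_ln_K_ball complex_cnj_diff
          complex_cnj_mult complex_cnj_cnj complex_cnj_complex_of_real)
    show ?thesis
      unfolding eq by (simp add: grad_log_ratio_def mu_def algebra_simps add_divide_distrib)
  qed
  from has_derivative_transform_within_open[OF holomorphic open_regular_set z grad]
  show ?thesis by blast
qed

lemma sesquiholomorphic_N: "sesquiholomorphic_on N regular_set unit_ball"
  and sesquiholomorphic_gradN: "sesquiholomorphic_on (\<lambda>z w. gradN z w $ k) regular_set unit_ball"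
proof -
  note left = gateaux_holomorphic_on_subset[OF gateaux_holomorphic_F regular_set_subset,
      THEN sesquiholomorphic_on_left] gateaux_holomorphic_F'[THEN sesquiholomorphic_on_left]
  note right = sesquiholomorphic_on_cnj_right[OF gateaux_holomorphic_F open_unit_ball]
  show "sesquiholomorphic_on N regular_set unit_ball"
    unfolding N_def[abs_def] generic_norm_IV_def cinner_def cdot_def cnj_sum
      complex_cnj_mult divide_inverse
    by (intro sesquiholomorphic_intros left right)
  show "sesquiholomorphic_on (\<lambda>z w. gradN z w $ k) regular_set unit_ball"
    unfolding gradN_def generic_norm_IV_deriv_def cinner_def cdot_def column_def
      vec_lambda_beta cnj_sum complex_cnj_mult divide_inverse
    by (intro sesquiholomorphic_intros left right)
qed

text \<open>At \<open>w = 0\<close> every term of the polarized formula for \<open>grad_log_ratio\<close> except the first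
  vanishes.\<close>
lemma gradN_eq:
  assumes z: "z \<in> regular_set" and w: "w \<in> unit_ball"
  shows "gradN z w $ k * generic_norm_ball z w = - (of_real mu * cnj (w $ k) * N z w)"
proof -
  define K where "K z w = grad_log_ratio z $ k * (N z w * generic_norm_ball z w)
      - (gradN z w $ k * generic_norm_ball z w + of_real mu * cnj (w $ k) * N z w)" for z w
  have K: "K z w = 0" if "w \<in> unit_ball" for w
  proof (rule sesquiholomorphic_eq_0_if_local_diagonal_eq_0[OF _ open_regular_set open_unit_ball
      convex_unit_ball regular_set_subset _ z that])
    have "gateaux_holomorphic_on (\<lambda>z. grad_log_ratio z $ k) regular_set"
      using grad_log_ratio_has_derivative by (rule gateaux_holomorphic_onI)
    then show "sesquiholomorphic_on K regular_set unit_ball"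
      unfolding K_def[abs_def]
      by (intro sesquiholomorphic_intros sesquiholomorphic_N sesquiholomorphic_gradN
          sesquiholomorphic_generic_norm_ball sesquiholomorphic_on_left
          sesquiholomorphic_on_cnj_right gateaux_holomorphic_on_nth open_unit_ball)
    fix x assume "x \<in> regular_set"
    then have "x \<in> unit_ball" using regular_set_subset by blast
    then have "N x x \<noteq> 0" "generic_norm_ball x x \<noteq> 0"
      using Re_N_pos generic_norm_ball_nonzero by force+
    then show "K x x = 0" by (simp add: K_def grad_log_ratio_def field_simps)
  qed
  have "grad_log_ratio z $ k = 0"
    using K[of 0] by (simp add: K_def generic_norm_ball_def)
  then show ?thesis using K[OF w] by (simp add: K_def) (metis minus_minus)
qed

section \<open>The isometric constant\<close>

lemma N_line_has_field_derivative:
  assumes "t *s z \<in> unit_ball"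
  shows "((\<lambda>t. N (t *s z) w) has_field_derivative gradN (t *s z) w \<cdot> z) (at t)"
  using has_field_derivative_line[of "\<lambda>z. N z w" _ 0 t z] N_has_derivative[OF assms] by simp

lemma gradN_line_eq:
  assumes "t *s z \<in> regular_set" "w \<in> unit_ball"
  shows "(gradN (t *s z) w \<cdot> z) * generic_norm_ball (t *s z) w
      = - (of_real mu * \<langle>z, w\<rangle> * N (t *s z) w)"
proof -
  have "(gradN (t *s z) w \<cdot> z) * generic_norm_ball (t *s z) w
      = (\<Sum>k\<in>UNIV. (gradN (t *s z) w $ k * generic_norm_ball (t *s z) w) * z $ k)"
    by (simp add: cdot_def sum_distrib_left mult_ac)
  also have "\<dots> = - (of_real mu * \<langle>z, w\<rangle> * N (t *s z) w)"
    unfolding gradN_eq[OF assms]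
    by (simp add: cinner_def sum_distrib_left sum_distrib_right sum_negf algebra_simps)
  finally show ?thesis .
qed

lemma N_line_rational:
  "\<exists>A B. \<forall>t. t *s z \<in> regular_set \<longrightarrow> poly B t \<noteq> 0 \<and> N (t *s z) w = poly A t / poly B t"
proof -
  obtain r where r: "\<And>t. mpeval R (t *s z) = poly r t" using mpeval_line_through_0 by blast
  have "\<forall>i. \<exists>p. \<forall>t. mpeval (P $ i) (t *s z) = poly p t" using mpeval_line_through_0 by blast
  then obtain p where p: "\<And>i t. mpeval (P $ i) (t *s z) = poly (p i) t" by metis
  define A where "A = r\<^sup>2 - r * (\<Sum>i\<in>UNIV. smult (cnj (F w $ i)) (p i))
    + smult (cnj (F w \<cdot> F w) / 4) (\<Sum>i\<in>UNIV. (p i)\<^sup>2)"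
  show ?thesis
  proof (intro exI allI impI)
    fix t assume t: "t *s z \<in> regular_set"
    then have r_nonzero: "poly r t \<noteq> 0" by (simp add: regular_set_def r)
    have "F (t *s z) = (1 / poly r t) *s (\<chi> i. poly (p i) t)"
      using F_rational[OF t] by (simp add: vec_eq_iff p r)
    then show "poly (r\<^sup>2) t \<noteq> 0 \<and> N (t *s z) w = poly A t / poly (r\<^sup>2) t"
      using r_nonzero
      by (simp add: N_def generic_norm_IV_def A_def poly_sum cinner_def
          cdot_self[of "\<chi> i. poly (p i) t"] power2_eq_square field_simps sum_distrib_left)
  qed
qed

lemma mu_nat: "\<exists>k::nat. mu = real k"
proof -
  have "\<not> regular_set \<subseteq> {0}"
    using finite_imp_not_open[of regular_set] open_regular_set regular_set_nonempty finite_subset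
    by blast
  then obtain z where z: "z \<in> regular_set" "z \<noteq> 0" by blast
  then have z_ball: "z \<in> unit_ball" using regular_set_subset by blast
  define S where "S = {t. t *s z \<in> regular_set}"
  have S: "open S" "1 \<in> S"
    using open_line_vimage[OF open_regular_set, of 0 z] z(1) by (simp_all add: S_def)
  have S_ball: "t *s z \<in> unit_ball" if "t \<in> S" for t
    using that regular_set_subset by (auto simp: S_def)
  obtain A B where "\<forall>t. t *s z \<in> regular_set \<longrightarrow> poly B t \<noteq> 0 \<and> N (t *s z) z = poly A t / poly B t"
    using N_line_rational[of z z] by (elim exE)
  then have N_eq: "poly B t \<noteq> 0 \<and> N (t *s z) z = poly A t / poly B t" if "t \<in> S" for t
    using that by (simp add: S_def)
  have "\<exists>a b :: nat. complex_of_real mu = of_nat a - of_nat b"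
  proof (rule rational_log_derivative_exponent[OF S _ _ N_eq])
    show "N (1 *s z) z \<noteq> 0" using Re_N_pos[OF z_ball] by force
    show "\<langle>z, z\<rangle> \<noteq> 0" using z(2) by (simp add: cinner_self)
    fix t assume t: "t \<in> S"
    show "((\<lambda>t. N (t *s z) z) has_field_derivative gradN (t *s z) z \<cdot> z) (at t)"
      by (rule N_line_has_field_derivative[OF S_ball[OF t]])
    show "(gradN (t *s z) z \<cdot> z) * (1 - t * \<langle>z, z\<rangle>) = - (of_real mu * \<langle>z, z\<rangle> * N (t *s z) z)"
      using gradN_line_eq[of t z z] t z_ball by (simp add: S_def generic_norm_ball_def)
  qed
  then obtain a b :: nat where "complex_of_real mu = of_real (real a - real b)" by auto
  then have "mu = real a - real b" by (simp only: of_real_eq_iff)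
  then have "mu = real (a - b)" using mu_pos by simp
  then show ?thesis by blast
qed

lemma N_eq_power_on_regular_set:
  assumes k: "mu = real k" and z: "z \<in> regular_set" and w: "w \<in> unit_ball"
  shows "N z w = generic_norm_ball z w ^ k"
proof -
  define S where "S = {t. t *s z \<in> unit_ball}"
  obtain r where r: "\<And>t. mpeval R (t *s z) = poly r t" using mpeval_line_through_0 by blast
  have "poly r 1 \<noteq> 0" using z r[of 1] by (simp add: regular_set_def)
  then have "r \<noteq> 0" by auto
  have "1 \<in> S" using z regular_set_subset by (auto simp: S_def)
  have nonzero: "generic_norm_ball (t *s z) w \<noteq> 0" if "t \<in> S" for t
    using that generic_norm_ball_nonzero w by (simp add: S_def)
  have "N (1 *s z) w / generic_norm_ball (1 *s z) w ^ k
      = N (0 *s z) w / generic_norm_ball (0 *s z) w ^ k"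
  proof (rule quotient_power_constant_if_log_derivative_eq[of S "{t. poly r t = 0}"])
    show "open S" "connected S"
      using open_line_vimage[OF open_unit_ball, of 0 z]
        convex_line_vimage[OF convex_unit_ball, of 0 z]
      by (simp_all add: S_def convex_connected)
    show "finite {t. poly r t = 0}" by (rule poly_roots_finite[OF \<open>r \<noteq> 0\<close>])
    show "((\<lambda>t. N (t *s z) w) has_field_derivative gradN (t *s z) w \<cdot> z) (at t)" if "t \<in> S" for t
      using that by (simp add: S_def N_line_has_field_derivative)
    show "((\<lambda>t. generic_norm_ball (t *s z) w) has_field_derivative - \<langle>z, w\<rangle>) (at t)" for t
      by (auto simp: generic_norm_ball_def intro!: derivative_eq_intros)
    show "(gradN (t *s z) w \<cdot> z) * generic_norm_ball (t *s z) w
        = of_nat k * - \<langle>z, w\<rangle> * N (t *s z) w"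
      if "t \<in> S - {t. poly r t = 0}" for t
      using gradN_line_eq[of t z w] that w by (simp add: S_def regular_set_def r k)
  qed (use nonzero \<open>1 \<in> S\<close> in \<open>simp_all add: S_def\<close>)
  then show ?thesis
    using nonzero[OF \<open>1 \<in> S\<close>] by (simp add: N_def generic_norm_IV_def generic_norm_ball_def F_0)
qed

lemma N_eq_power:
  assumes k: "mu = real k" and z: "z \<in> unit_ball" and w: "w \<in> unit_ball"
  shows "N z w = generic_norm_ball z w ^ k"
proof (rule eq_on_unit_ball_if_eq_on_regular_set[of "\<lambda>z. N z w" "\<lambda>z. generic_norm_ball z w ^ k",
    OF _ _ _ z])
  show "continuous_on unit_ball (\<lambda>z. N z w)"
    unfolding N_def generic_norm_IV_def by (intro continuous_intros continuous_F) simp_all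
  show "continuous_on unit_ball (\<lambda>z. generic_norm_ball z w ^ k)"
    unfolding generic_norm_ball_def by (intro continuous_intros)
qed (rule N_eq_power_on_regular_set[OF k _ w])

lemma mu_eq_1:
  assumes card: "CARD('n) \<ge> 2"
  shows "mu = 1"
proof -
  obtain k :: nat where k: "mu = real k" using mu_nat by blast
  obtain v where v: "v \<noteq> 0" "(F' 0 *v v) \<cdot> (F' 0 *v v) = 0"
    by (rule isotropic_vector_exists[of "(*v) (F' 0)"])
       (use card in \<open>simp_all add: matrix_vector_right_distrib vector_scalar_commute\<close>)
  define S where "S = {t. t *s v \<in> unit_ball}"
  have S: "open S" "0 \<in> S"
    using open_line_vimage[OF open_unit_ball, of 0 v] by (simp_all add: S_def)
  have "k \<le> 1"
  proof (rule gram_power_exponent_le_1[OF S])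
    show "(\<lambda>t. F (t *s v) $ i) holomorphic_on S" for i
      using gateaux_holomorphic_F[of i, unfolded gateaux_holomorphic_on_def, rule_format, of 0 v]
      by (simp add: S_def)
    have "((\<lambda>t. F (t *s v) $ i) has_field_derivative F' 0 $ i \<cdot> v) (at 0)" for i
      using has_field_derivative_line[of "\<lambda>z. F z $ i" _ 0 0 v] F_nth_has_derivative[of 0 i] by simp
    from DERIV_imp_deriv[OF this] show "(\<Sum>i\<in>UNIV. (deriv (\<lambda>t. F (t *s v) $ i) 0)\<^sup>2) = 0"
      using v(2) by (simp add: cdot_self matrix_vector_mult_nth)
    fix t s assume "t \<in> S" "s \<in> S"
    then have "N (t *s v) (s *s v) = (1 - t * (cnj s * of_real ((norm v)\<^sup>2))) ^ k"
      by (subst N_eq_power[OF k]) (simp_all add: S_def generic_norm_ball_def cinner_self mult_ac)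
    then show "\<langle>F (t *s v), F (s *s v)\<rangle>
        - (F (t *s v) \<cdot> F (t *s v)) * (cnj (F (s *s v) \<cdot> F (s *s v)) / 4)
        = 1 - (1 - t * (cnj s * of_real ((norm v)\<^sup>2))) ^ k"
      by (simp add: N_def generic_norm_IV_def algebra_simps)
  qed (use v F_0 in simp_all)
  moreover have "k \<noteq> 0" using k mu_pos by auto
  ultimately show ?thesis using k by simp
qed

section \<open>The shape of the isometry\<close>

definition g :: "complex^'n \<Rightarrow> complex" where "g z = (F z \<cdot> F z) / 2"

definition nonlinear_part :: "complex^'n \<Rightarrow> complex^'m" where
  "nonlinear_part z = F z - F' 0 *v z"

lemma g_0: "g 0 = 0"
  by (simp add: g_def F_0)

lemma continuous_g: "continuous_on unit_ball g"
  unfolding g_def[abs_def] by (intro continuous_intros continuous_F) simp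

lemma g_has_derivative_0: "(g has_derivative (\<lambda>v. 0)) (at 0)"
  unfolding g_def[abs_def]
  by (auto intro!: derivative_eq_intros F_has_derivative simp: F_0)

context
  assumes card: "CARD('n) \<ge> 2"
begin

lemma cinner_F:
  assumes "z \<in> unit_ball" "w \<in> unit_ball"
  shows "\<langle>F z, F w\<rangle> = \<langle>z, w\<rangle> + g z * cnj (g w)"
  using N_eq_power[of 1 z w] assms mu_eq_1[OF card]
  by (simp add: N_def generic_norm_IV_def generic_norm_ball_def g_def algebra_simps)

lemma cinner_linear_part_F:
  assumes z: "z \<in> unit_ball"
  shows "\<langle>F' 0 *v v, F z\<rangle> = \<langle>v, z\<rangle>"
proof -
  have "((\<lambda>w. \<langle>F w, F z\<rangle>) has_derivative (\<lambda>v. \<langle>F' 0 *v v, F z\<rangle>)) (at 0)"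
    by (auto intro!: derivative_eq_intros F_has_derivative)
  then have deriv_left: "((\<lambda>w. \<langle>w, z\<rangle> + g w * cnj (g z))
      has_derivative (\<lambda>v. \<langle>F' 0 *v v, F z\<rangle>)) (at 0)"
    by (rule has_derivative_transform_within_open[OF _ open_unit_ball zero_in_unit_ball])
       (rule cinner_F[OF _ z])
  have deriv_right: "((\<lambda>w. \<langle>w, z\<rangle> + g w * cnj (g z)) has_derivative (\<lambda>v. \<langle>v, z\<rangle>)) (at 0)"
    by (auto intro!: derivative_eq_intros g_has_derivative_0)
  from fun_cong[OF has_derivative_unique[OF deriv_left deriv_right], of v] show ?thesis .
qed

lemma linear_part_isometric: "\<langle>F' 0 *v u, F' 0 *v v\<rangle> = \<langle>u, v\<rangle>"
proof -
  have "((\<lambda>w. \<langle>F w, F' 0 *v v\<rangle>) has_derivative (\<lambda>u. \<langle>F' 0 *v u, F' 0 *v v\<rangle>)) (at 0)"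
    by (auto intro!: derivative_eq_intros F_has_derivative)
  then have deriv_left: "((\<lambda>w. \<langle>w, v\<rangle>) has_derivative (\<lambda>u. \<langle>F' 0 *v u, F' 0 *v v\<rangle>)) (at 0)"
    by (rule has_derivative_transform_within_open[OF _ open_unit_ball zero_in_unit_ball])
       (metis cinner_linear_part_F cnj_cinner)
  have deriv_right: "((\<lambda>w. \<langle>w, v\<rangle>) has_derivative (\<lambda>u. \<langle>u, v\<rangle>)) (at 0)"
    by (auto intro!: derivative_eq_intros)
  from fun_cong[OF has_derivative_unique[OF deriv_left deriv_right], of u] show ?thesis .
qed

lemma cinner_linear_part_nonlinear_part:
  "z \<in> unit_ball \<Longrightarrow> \<langle>F' 0 *v v, nonlinear_part z\<rangle> = 0"
  by (simp add: nonlinear_part_def cinner.diff_right cinner_linear_part_F linear_part_isometric)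

lemma cinner_nonlinear_part:
  assumes z: "z \<in> unit_ball" and w: "w \<in> unit_ball"
  shows "\<langle>nonlinear_part z, nonlinear_part w\<rangle> = g z * cnj (g w)"
proof -
  have "\<langle>nonlinear_part z, nonlinear_part w\<rangle> = \<langle>F z, nonlinear_part w\<rangle>"
    using cinner_linear_part_nonlinear_part[OF w]
    by (simp add: nonlinear_part_def[of z] cinner.diff_left)
  also have "\<dots> = \<langle>F z, F w\<rangle> - \<langle>F z, F' 0 *v w\<rangle>"
    by (simp add: nonlinear_part_def cinner.diff_right)
  also have "\<langle>F z, F' 0 *v w\<rangle> = \<langle>z, w\<rangle>"
    by (metis cinner_linear_part_F[OF z] cnj_cinner)
  finally show ?thesis using cinner_F[OF z w] by simp
qed

lemma F_eq_linear_part_plus: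
  obtains "\<And>z. z \<in> unit_ball \<Longrightarrow> F z = F' 0 *v z"
  | b where "\<And>v. \<langle>F' 0 *v v, b\<rangle> = 0" "\<langle>b, b\<rangle> = 1"
    "\<And>z. z \<in> unit_ball \<Longrightarrow> F z = F' 0 *v z + g z *s b"
proof (cases "\<forall>w\<in>unit_ball. g w = 0")
  case True
  then have "nonlinear_part z = 0" if "z \<in> unit_ball" for z
    using cinner_nonlinear_part[OF that that] that by (simp add: cinner_self)
  then show ?thesis using that(1) by (simp add: nonlinear_part_def)
next
  case False
  then obtain w where w: "w \<in> unit_ball" "g w \<noteq> 0" by blast
  define b where "b = (1 / g w) *s nonlinear_part w"
  show ?thesis
  proof (rule that(2)[of b])
    show "\<langle>F' 0 *v v, b\<rangle> = 0" for v
      using cinner_linear_part_nonlinear_part[OF w(1)] by (simp add: b_def)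
    show "\<langle>b, b\<rangle> = 1"
      unfolding b_def
      by (rule rank_one_gram(1)[of unit_ball nonlinear_part g w, OF cinner_nonlinear_part w])
    fix z :: "complex^'n" assume z: "z \<in> unit_ball"
    have "nonlinear_part z = g z *s b"
      unfolding b_def
      by (rule rank_one_gram(2)[of unit_ball nonlinear_part g w, OF cinner_nonlinear_part w z])
    then show "F z = F' 0 *v z + g z *s b"
      by (simp add: nonlinear_part_def algebra_simps)
  qed
qed

end

definition linear_component :: "'m \<Rightarrow> 'n mpoly" where
  "linear_component i = linear_form (F' 0 $ i)"

lemma mpeval_linear_component [simp]: "mpeval (linear_component i) z = (F' 0 *v z) $ i"
  by (simp add: linear_component_def matrix_vector_mult_nth)

lemma mdeg_linear_component_le: "mdeg (linear_component i) \<le> 1"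
  unfolding linear_component_def by (rule mdeg_linear_form_le)

lemma mpoly_eqI_regular_set: "(\<And>z. z \<in> regular_set \<Longrightarrow> mpeval p z = mpeval q z) \<Longrightarrow> p = q"
  by (rule mpoly_eqI_open[OF open_regular_set regular_set_nonempty])

lemma mpeval_P: "z \<in> regular_set \<Longrightarrow> mpeval (P $ i) z = mpeval R z * F z $ i"
  by (simp add: F_rational regular_set_def)

lemma common_factor_const:
  assumes "D dvd R" "\<And>i. D dvd P $ i"
  obtains s where "s \<noteq> 0" "D = mconst s"
  using assms rational mpoly_unit_const unfolding rational_rep_def lowest_terms_rep_def by metis

lemma rdeg_le_if_linear:
  assumes "\<And>z. z \<in> unit_ball \<Longrightarrow> F z = F' 0 *v z"
  shows "rdeg P R \<le> 1"
proof -
  have P: "P $ i = R * linear_component i" for i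
    using assms regular_set_subset by (intro mpoly_eqI_regular_set) (auto simp: mpeval_P)
  then obtain s where s: "R = mconst s" using common_factor_const[of R] by auto
  show ?thesis
    using mdeg_const_mult_le[OF mdeg_linear_component_le] by (simp add: rdeg_le_iff P s)
qed

end

section \<open>The degree of a nonlinear isometry\<close>

locale nonlinear_isometry = rational_isometry F P R c c' lam
  for F :: "complex^'n::finite \<Rightarrow> complex^'m::finite"
    and P :: "('n mpoly)^'m" and R :: "'n mpoly" and c c' lam :: real +
  fixes b :: "complex^'m"
  assumes b_orth: "\<And>v. \<langle>F' 0 *v v, b\<rangle> = 0" and b_unit: "\<langle>b, b\<rangle> = 1"
    and F_eq: "\<And>z. z \<in> unit_ball \<Longrightarrow> F z = F' 0 *v z + g z *s b"
begin

definition cross_term :: "'n mpoly" where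
  "cross_term = linear_form (transpose (F' 0) *v b)"

definition quadratic_term :: "'n mpoly" where
  "quadratic_term = (\<Sum>i\<in>UNIV. linear_component i * linear_component i)"

definition g_numerator :: "'n mpoly" where
  "g_numerator = (\<Sum>i\<in>UNIV. mconst (cnj (b $ i)) * P $ i)"

lemma mpeval_cross_term [simp]: "mpeval cross_term z = (F' 0 *v z) \<cdot> b"
  by (simp add: cross_term_def cdot_matrix_vector_mult)

lemma mpeval_quadratic_term [simp]: "mpeval quadratic_term z = (F' 0 *v z) \<cdot> (F' 0 *v z)"
  by (simp add: quadratic_term_def cdot_def)

lemma homogeneous_quadratic_term: "homogeneous 2 quadratic_term"
  by (simp add: homogeneous_def vector_scalar_commute power2_eq_square)

lemma mpeval_g_numerator: "z \<in> regular_set \<Longrightarrow> mpeval g_numerator z = mpeval R z * g z"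
proof -
  assume z: "z \<in> regular_set"
  then have "z \<in> unit_ball" using regular_set_subset by blast
  have "mpeval g_numerator z = mpeval R z * \<langle>F z, b\<rangle>"
    by (simp add: g_numerator_def mpeval_P[OF z] cinner_def sum_distrib_left algebra_simps)
  also have "\<langle>F z, b\<rangle> = g z"
    by (subst F_eq[OF \<open>z \<in> unit_ball\<close>]) (simp add: cinner.add_left b_orth b_unit)
  finally show ?thesis .
qed

lemma P_eq: "P $ i = R * linear_component i + mconst (b $ i) * g_numerator"
proof (rule mpoly_eqI_regular_set)
  fix z assume z: "z \<in> regular_set"
  then have "z \<in> unit_ball" using regular_set_subset by blast
  from arg_cong[OF F_eq[OF this], of "\<lambda>x. x $ i"]
  show "mpeval (P $ i) z = mpeval (R * linear_component i + mconst (b $ i) * g_numerator) z"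
    by (simp add: mpeval_P[OF z] mpeval_g_numerator[OF z] algebra_simps)
qed

lemma g_numerator_quadratic:
  "mconst (b \<cdot> b) * (g_numerator * g_numerator) + quadratic_term * (R * R)
    = mconst 2 * ((1 - cross_term) * (g_numerator * R))"
proof (rule mpoly_eqI_regular_set)
  fix z assume z: "z \<in> regular_set"
  then have "z \<in> unit_ball" using regular_set_subset by blast
  have "2 * g z = F z \<cdot> F z" by (simp add: g_def)
  also have "F z = F' 0 *v z + g z *s b" by (rule F_eq[OF \<open>z \<in> unit_ball\<close>])
  also have "(F' 0 *v z + g z *s b) \<cdot> (F' 0 *v z + g z *s b)
      = mpeval quadratic_term z + 2 * (g z * mpeval cross_term z) + (b \<cdot> b) * (g z)\<^sup>2"
    by (simp add: cdot.add_left cdot.add_right cdot_commute[of b "F' 0 *v z"] power2_eq_square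
      algebra_simps)
  finally have "(b \<cdot> b) * (g z)\<^sup>2 + mpeval quadratic_term z = 2 * ((1 - mpeval cross_term z) * g z)"
    by (simp add: algebra_simps)
  from arg_cong[OF this, of "\<lambda>x. (mpeval R z)\<^sup>2 * x"]
  show "mpeval (mconst (b \<cdot> b) * (g_numerator * g_numerator) + quadratic_term * (R * R)) z
      = mpeval (mconst 2 * ((1 - cross_term) * (g_numerator * R))) z"
    by (simp add: mpeval_g_numerator[OF z] power2_eq_square algebra_simps
        del: mpeval_cross_term mpeval_quadratic_term)
qed

lemma linear_if_quadratic_term_eq_0:
  assumes vanish: "quadratic_term = 0" and z: "z \<in> unit_ball"
  shows "F z = F' 0 *v z"
proof -
  have "g_numerator * (mconst (b \<cdot> b) * g_numerator - mconst 2 * ((1 - cross_term) * R)) = 0"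
    using g_numerator_quadratic by (simp add: vanish algebra_simps)
  then consider (zero) "g_numerator = 0"
    | (other_root) "mconst (b \<cdot> b) * g_numerator = mconst 2 * ((1 - cross_term) * R)"
    by (auto simp: mpoly_mult_eq_0_iff)
  then have "g z = 0"
  proof cases
    case zero
    then have "g w = 0" if "w \<in> regular_set" for w
      using mpeval_g_numerator[OF that] that by (simp add: regular_set_def)
    then show ?thesis
      by (intro eq_on_unit_ball_if_eq_on_regular_set[of g "\<lambda>_. 0", OF continuous_g _ _ z]) auto
  next
    case other_root
    have "(b \<cdot> b) * g 0 = 2 * (1 - mpeval cross_term 0)"
    proof (rule eq_on_unit_ball_if_eq_on_regular_set)
      show "continuous_on unit_ball (\<lambda>z. (b \<cdot> b) * g z)" by (intro continuous_intros continuous_g)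
      show "continuous_on unit_ball (\<lambda>z. 2 * (1 - mpeval cross_term z))"
        by (intro continuous_intros continuous_on_mpeval)
      fix w assume w: "w \<in> regular_set"
      have "mpeval (mconst (b \<cdot> b) * g_numerator) w
          = mpeval (mconst 2 * ((1 - cross_term) * R)) w"
        by (simp only: other_root)
      then have "mpeval R w * ((b \<cdot> b) * g w) = mpeval R w * (2 * (1 - mpeval cross_term w))"
        by (simp add: mpeval_g_numerator[OF w] algebra_simps)
      then show "(b \<cdot> b) * g w = 2 * (1 - mpeval cross_term w)"
        using w by (simp add: regular_set_def)
    qed simp
    then show ?thesis by (simp add: g_0)
  qed
  then show ?thesis using F_eq[OF z] by simp
qed

text \<open>Otherwise the discriminant \<open>(1 - cross_term)\<^sup>2 - (b \<cdot> b) quadratic_term\<close> would be the square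
  of a rational function on every line through 0.\<close>
lemma b_isotropic:
  assumes "quadratic_term \<noteq> 0" shows "b \<cdot> b = 0"
proof (rule ccontr)
  assume \<beta>: "b \<cdot> b \<noteq> 0"
  have "R * quadratic_term \<noteq> 0" using assms R_nonzero by (simp add: mpoly_mult_eq_0_iff)
  then obtain z where "mpeval (R * quadratic_term) z \<noteq> 0" using mpoly_nonzero_somewhere by blast
  then have z: "mpeval R z \<noteq> 0" "mpeval quadratic_term z \<noteq> 0" by simp_all
  obtain r where r: "\<And>t. mpeval R (t *s z) = poly r t" using mpeval_line_through_0 by blast
  obtain s where s: "\<And>t. mpeval g_numerator (t *s z) = poly s t"
    using mpeval_line_through_0 by blast
  define \<alpha> d where "\<alpha> = mpeval cross_term z" and "d = (b \<cdot> b) * mpeval quadratic_term z"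
  define X where "X = smult (b \<cdot> b) s - [:1, - \<alpha>:] * r"
  have "X\<^sup>2 = [:1, - 2 * \<alpha>, \<alpha>\<^sup>2 - d:] * r\<^sup>2"
  proof (rule poly_ext)
    fix t
    have on_line: "mpeval cross_term (t *s z) = t * \<alpha>"
      "mpeval quadratic_term (t *s z) = t\<^sup>2 * mpeval quadratic_term z"
      using homogeneous_quadratic_term
      by (simp_all add: homogeneous_def \<alpha>_def vector_scalar_commute del: mpeval_quadratic_term)
    have "(b \<cdot> b) * (poly s t)\<^sup>2 + t\<^sup>2 * mpeval quadratic_term z * (poly r t)\<^sup>2
        = 2 * ((1 - t * \<alpha>) * (poly s t * poly r t))"
      using arg_cong[OF g_numerator_quadratic, of "\<lambda>p. mpeval p (t *s z)"]
      by (simp add: r s on_line power2_eq_square del: mpeval_cross_term mpeval_quadratic_term)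
    from arg_cong[OF this, of "\<lambda>x. (b \<cdot> b) * x"]
    show "poly (X\<^sup>2) t = poly ([:1, - 2 * \<alpha>, \<alpha>\<^sup>2 - d:] * r\<^sup>2) t"
      by (simp add: X_def d_def power2_eq_square algebra_simps del: mpeval_quadratic_term)
  qed
  moreover have "r \<noteq> 0" using r[of 1] z by auto
  moreover obtain t where "poly [:1, - 2 * \<alpha>, \<alpha>\<^sup>2 - d:] t = 0"
      "poly (pderiv [:1, - 2 * \<alpha>, \<alpha>\<^sup>2 - d:]) t \<noteq> 0"
    using discriminant_simple_root[of d \<alpha>] \<beta> z by (auto simp: d_def)
  ultimately show False by (rule square_multiple_no_simple_root)
qed

lemma rational_rep_if_quadratic_term_nonzero:
  assumes nonzero: "quadratic_term \<noteq> 0"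
  obtains s where "s \<noteq> 0" "R = mconst s * (1 - cross_term)"
    "\<And>i. P $ i = mconst s *
      ((1 - cross_term) * linear_component i + mconst (b $ i / 2) * quadratic_term)"
    "mconst s * quadratic_term = mconst 2 * g_numerator"
proof -
  have "R * (quadratic_term * R) = R * (mconst 2 * ((1 - cross_term) * g_numerator))"
    using g_numerator_quadratic b_isotropic[OF nonzero] by (simp add: mconst_def algebra_simps)
  then have qR: "quadratic_term * R = mconst 2 * ((1 - cross_term) * g_numerator)"
    using R_nonzero mpoly_mult_left_cancel by blast
  then have "(1 - cross_term) dvd quadratic_term * R" by simp
  then have "(1 - cross_term) dvd R"
    unfolding cross_term_def
    by (rule one_minus_linear_form_dvd_cancel_homogeneous[OF homogeneous_quadratic_term nonzero])
  then obtain S where S: "R = (1 - cross_term) * S" by (metis dvdE)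
  have "1 - cross_term \<noteq> 0"
    using mpeval_diff[of 1 cross_term 0]
    by (metis diff_zero mpeval_0 mpeval_1 mpeval_cross_term zero_neq_one
        matrix_vector_mult_0_right cdot.zero_left)
  moreover have "(1 - cross_term) * (quadratic_term * S)
      = (1 - cross_term) * (mconst 2 * g_numerator)"
    using qR by (simp add: S algebra_simps)
  ultimately have numerator: "quadratic_term * S = mconst 2 * g_numerator"
    by (rule mpoly_mult_left_cancel)
  have P: "P $ i = S *
      ((1 - cross_term) * linear_component i + mconst (b $ i / 2) * quadratic_term)" for i
  proof -
    have "mconst (b $ i) * g_numerator = mconst (b $ i / 2) * (mconst 2 * g_numerator)"
      by (rule mpoly_eqI) simp
    then show ?thesis unfolding P_eq numerator[symmetric] S by (simp add: algebra_simps)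
  qed
  obtain s where "s \<noteq> 0" "S = mconst s"
    using common_factor_const[of S] S P by auto
  then show ?thesis using that S P numerator by (simp add: mult.commute)
qed

lemma mdeg_one_minus_cross_term_le: "mdeg (1 - cross_term) \<le> 1"
  unfolding cross_term_def by (intro mdeg_diff_le mdeg_linear_form_le) simp

lemma mdeg_quadratic_term_le: "mdeg quadratic_term \<le> 2"
  unfolding quadratic_term_def
  using mdeg_mult_le[OF mdeg_linear_component_le mdeg_linear_component_le]
  by (intro mdeg_sum_le) (simp add: numeral_2_eq_2)

lemma rdeg_eq_2:
  assumes nonzero: "quadratic_term \<noteq> 0"
  shows "rdeg P R = 2"
proof -
  obtain s where s: "s \<noteq> 0" and R: "R = mconst s * (1 - cross_term)"
    and P: "\<And>i. P $ i = mconst s *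
      ((1 - cross_term) * linear_component i + mconst (b $ i / 2) * quadratic_term)"
    and numerator: "mconst s * quadratic_term = mconst 2 * g_numerator"
    using rational_rep_if_quadratic_term_nonzero[OF nonzero] by blast
  have "mdeg ((1 - cross_term) * linear_component i) \<le> 2" for i
    using mdeg_mult_le[OF mdeg_one_minus_cross_term_le mdeg_linear_component_le]
    by (simp add: numeral_2_eq_2)
  then have "mdeg (P $ i) \<le> 2" for i
    unfolding P by (intro mdeg_const_mult_le mdeg_add_le mdeg_quadratic_term_le)
  moreover have "mdeg R \<le> 2"
    unfolding R using mdeg_one_minus_cross_term_le by (intro mdeg_const_mult_le) simp
  ultimately have "rdeg P R \<le> 2" by (simp add: rdeg_le_iff)
  moreover have "mdeg g_numerator \<le> rdeg P R"
    unfolding g_numerator_def using rdeg_le_iff[of P R "rdeg P R"]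
    by (intro mdeg_sum_le mdeg_const_mult_le) simp
  moreover have "quadratic_term = mconst (1 / s) * (mconst s * quadratic_term)"
    using s by (intro mpoly_eqI) simp
  ultimately have "mdeg quadratic_term \<le> rdeg P R" unfolding numerator by (metis mdeg_const_mult_le)
  then show ?thesis
    using homogeneous_le_mdeg[OF homogeneous_quadratic_term nonzero] \<open>rdeg P R \<le> 2\<close> by simp
qed

end

theorem (in rational_isometry) linear_or_rdeg_eq_2:
  assumes "CARD('n) \<ge> 2"
  shows "(\<forall>z\<in>unit_ball. F z = F' 0 *v z) \<or> rdeg P R = 2"
proof (rule F_eq_linear_part_plus[OF assms])
  fix b
  assume "\<And>v. \<langle>F' 0 *v v, b\<rangle> = 0" "\<langle>b, b\<rangle> = 1"
    "\<And>z. z \<in> unit_ball \<Longrightarrow> F z = F' 0 *v z + g z *s b"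
  then interpret nonlinear_isometry F P R c c' lam b
    by unfold_locales
  show ?thesis using linear_if_quadratic_term_eq_0 rdeg_eq_2 by blast
qed blast

theorem mainTheorem8:
  fixes F :: "complex^'n::finite \<Rightarrow> complex^'m::finite"
    and P :: "('n mpoly)^'m" and R :: "'n mpoly"
    and c c' lam :: real
  assumes "CARD('m) \<ge> CARD('n) + 1" and "CARD('n) + 1 \<ge> 3"
    and "c > 0" and "c' > 0" and "lam > 0"
    and "holo_isometry c c' F lam"
    and "rational_rep F P R"
    and "F 0 = 0"
  shows "rdeg P R \<le> 2 \<and>
         ((\<exists>A :: complex^'n^'m. \<forall>z\<in>unit_ball. F z = A *v z) \<or> rdeg P R = 2)"
proof -
  interpret rational_isometry F P R c c' lam
    using assms by unfold_locales
  have "CARD('n) \<ge> 2" using assms(2) by simp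
  then consider (linear) "\<forall>z\<in>unit_ball. F z = F' 0 *v z" | (quadratic) "rdeg P R = 2"
    using linear_or_rdeg_eq_2 by blast
  then show ?thesis
  proof cases
    case linear
    then have "rdeg P R \<le> 1" by (intro rdeg_le_if_linear) blast
    then show ?thesis using linear by auto
  qed simp
qed

end
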